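(* Let $G$ be a simple graph. Then $G\in\mathcal{G}^*$ if and only if every block $B$ of $G$ satisfies one of the following: (i) $B$ is bipartite; or (ii) $B\cong K_4$; or (iii) $B\cong \Theta_{1,p_1,\ldots,p_r}$ for some $r\ge 1$ and some even positive integers $p_1,\ldots,p_r$.
   Context: All graphs are simple. $\mathcal{G}^*$ denotes the class of graphs $G$ such that any two distinct odd cycles $C_1,C_2$ of $G$ satisfy $|E(C_1)\cap E(C_2)|\le 1$. A block of a graph is a maximal $2$-connected subgraph. For positive integers $p_1,\ldots,p_k$, the $\Theta$-graph $\Theta_{p_1,\ldots,p_k}$ is the graph obtained from two vertices $x_1,x_2$ joined by $k$ internally disjoint paths, the $i$th path having $p_i$ edges. If $p_i=1$, the $i$th path is the single edge $x_1x_2$. *)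

theory Defs
  imports Main
begin

text \<open>A finite simple graph is a pair (V, E): a finite vertex set V and a set E of
  2-element subsets of V.\<close>

definition simple_graph :: "'a set \<Rightarrow> 'a set set \<Rightarrow> bool" where
  "simple_graph V E \<longleftrightarrow> finite V \<and>
     (\<forall>e\<in>E. \<exists>u v. u \<noteq> v \<and> u \<in> V \<and> v \<in> V \<and> e = {u, v})"

definition subgraph :: "'a set \<Rightarrow> 'a set set \<Rightarrow> 'a set \<Rightarrow> 'a set set \<Rightarrow> bool" where
  "subgraph V' E' V E \<longleftrightarrow> V' \<subseteq> V \<and> E' \<subseteq> E \<and> (\<forall>e\<in>E'. e \<subseteq> V')"

definition connected :: "'a set \<Rightarrow> 'a set set \<Rightarrow> bool" where
  "connected V E \<longleftrightarrow> V \<noteq> {} \<and>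
     (\<forall>u\<in>V. \<forall>v\<in>V. (u, v) \<in> {(x, y). {x, y} \<in> E \<and> x \<in> V \<and> y \<in> V}\<^sup>*)"

text \<open>2-connected: at least 3 vertices, connected, and stays connected after deleting
  any single vertex.\<close>
definition two_connected :: "'a set \<Rightarrow> 'a set set \<Rightarrow> bool" where
  "two_connected V E \<longleftrightarrow> card V \<ge> 3 \<and> connected V E \<and>
     (\<forall>x\<in>V. connected (V - {x}) {e \<in> E. x \<notin> e})"

text \<open>A block: a maximal 2-connected subgraph.\<close>
definition is_block :: "'a set \<Rightarrow> 'a set set \<Rightarrow> 'a set \<Rightarrow> 'a set set \<Rightarrow> bool" where
  "is_block V E VB EB \<longleftrightarrow> subgraph VB EB V E \<and> two_connected VB EB \<and>
     (\<forall>V' E'. subgraph V' E' V E \<and> two_connected V' E' \<and> VB \<subseteq> V' \<and> EB \<subseteq> E'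
        \<longrightarrow> V' = VB \<and> E' = EB)"

text \<open>A cycle is given by a list of distinct vertices v0 ... v(k-1), k >= 3, with
  consecutive vertices (cyclically) adjacent; it is identified with its edge set.\<close>
definition cycle_edges :: "'a list \<Rightarrow> 'a set set" where
  "cycle_edges xs = {{xs ! i, xs ! ((i + 1) mod length xs)} | i. i < length xs}"

definition is_cycle :: "'a set \<Rightarrow> 'a set set \<Rightarrow> 'a list \<Rightarrow> bool" where
  "is_cycle V E xs \<longleftrightarrow> length xs \<ge> 3 \<and> distinct xs \<and> set xs \<subseteq> V \<and> cycle_edges xs \<subseteq> E"

definition odd_cycles :: "'a set \<Rightarrow> 'a set set \<Rightarrow> 'a set set set" where
  "odd_cycles V E = {cycle_edges xs | xs. is_cycle V E xs \<and> odd (length xs)}"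

text \<open>The class G*: any two distinct odd cycles share at most one edge.\<close>
definition G_star :: "'a set \<Rightarrow> 'a set set \<Rightarrow> bool" where
  "G_star V E \<longleftrightarrow> (\<forall>C1 \<in> odd_cycles V E. \<forall>C2 \<in> odd_cycles V E.
      C1 \<noteq> C2 \<longrightarrow> card (C1 \<inter> C2) \<le> 1)"

definition bipartite :: "'a set \<Rightarrow> 'a set set \<Rightarrow> bool" where
  "bipartite V E \<longleftrightarrow> (\<exists>A \<subseteq> V. \<forall>e\<in>E. \<exists>u v. e = {u, v} \<and> u \<in> A \<and> v \<in> V - A)"

definition graph_iso :: "'a set \<Rightarrow> 'a set set \<Rightarrow> 'b set \<Rightarrow> 'b set set \<Rightarrow> bool" where
  "graph_iso V E W F \<longleftrightarrow> (\<exists>f. bij_betw f V W \<and>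
     (\<forall>u\<in>V. \<forall>v\<in>V. {u, v} \<in> E \<longleftrightarrow> {f u, f v} \<in> F))"

definition K4_verts :: "nat set" where "K4_verts = {0..<4}"
definition K4_edges :: "nat set set" where
  "K4_edges = {{i, j} | i j. i < 4 \<and> j < 4 \<and> i \<noteq> j}"

text \<open>Theta graph Theta_{q_0,...,q_{k-1}}: endpoints x1 = (0,0), x2 = (0,1); path i has
  q_i edges and internal vertices (i+1, j) for 0 < j < q_i.\<close>
definition theta_vertex :: "nat list \<Rightarrow> nat \<Rightarrow> nat \<Rightarrow> nat \<times> nat" where
  "theta_vertex qs i j = (if j = 0 then (0, 0) else if j = qs ! i then (0, 1) else (i + 1, j))"

definition theta_verts :: "nat list \<Rightarrow> (nat \<times> nat) set" where
  "theta_verts qs = {(0, 0), (0, 1)} \<union> {(i + 1, j) | i j. i < length qs \<and> 0 < j \<and> j < qs ! i}"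

definition theta_edges :: "nat list \<Rightarrow> (nat \<times> nat) set set" where
  "theta_edges qs = {{theta_vertex qs i j, theta_vertex qs i (j + 1)} | i j.
      i < length qs \<and> j < qs ! i}"

end

theory Submission
  imports Defs
begin

text \<open>
  If three internally disjoint paths with common ends do not all have lengths of the same parity,
  then two of the three cycles they form are odd and share the path whose parity differs, so in
  a graph of the class that path is a single edge. In a non-bipartite block, take an edge whose
  ends are joined by a maximum number of internally disjoint paths of even length, and suppose
  that this theta graph is not the whole block, so that it has an ear. The three-path
  observation excludes ears with both ends on one of the paths: they either violate the class
  or yield a theta graph with more paths. It forces an ear between two different paths, and those
  paths, to be as short as possible, which gives a \<open>K\<^sub>4\<close>; and a \<open>K\<^sub>4\<close> in the class admits
  no ear.

  Conversely, two odd cycles that share an edge have a 2-connected union and hence lie in one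
  block. In a theta graph with one edge and otherwise even paths, an odd cycle consists of the
  edge and one of the paths, since the rest is bipartite and inner vertices have degree 2.
\<close>

section \<open>Paths and cycles as vertex lists\<close>

fun path_edges :: "'a list \<Rightarrow> 'a set set" where
  "path_edges (x # y # xs) = insert {x, y} (path_edges (y # xs))"
| "path_edges _ = {}"

lemma path_edges_append:
  "path_edges (xs @ x # ys) = path_edges (xs @ [x]) \<union> path_edges (x # ys)"
  by (induction xs rule: path_edges.induct) (cases ys; auto)+

lemma path_edges_snoc: "path_edges (xs @ [x, y]) = insert {x, y} (path_edges (xs @ [x]))"
  using path_edges_append[of xs x "[y]"] by simp

lemma path_edges_rev [simp]: "path_edges (rev xs) = path_edges xs"
  by (induction xs rule: path_edges.induct) (auto simp: path_edges_snoc insert_commute)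

text \<open>The indexed form connects the recursive description with \<open>cycle_edges\<close> and
  \<open>theta_edges\<close>, which are given by positions.\<close>

lemma path_edges_conv_nth: "path_edges xs = {{xs ! j, xs ! Suc j} | j. Suc j < length xs}"
proof (induction xs rule: path_edges.induct)
  case (1 x y xs)
  have "{{(x # y # xs) ! j, (x # y # xs) ! Suc j} | j. Suc j < length (x # y # xs)}
    = insert {x, y} {{(y # xs) ! j, (y # xs) ! Suc j} | j. Suc j < length (y # xs)}"
    (is "?L = ?R")
  proof
    show "?L \<subseteq> ?R"
    proof
      fix e assume "e \<in> ?L"
      then obtain j where "e = {(x # y # xs) ! j, (x # y # xs) ! Suc j}"
        "Suc j < length (x # y # xs)" by blast
      then show "e \<in> ?R" by (cases j) auto
    qed
    show "?R \<subseteq> ?L"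
    proof
      fix e assume "e \<in> ?R"
      then consider "e = {x, y}"
        | j where "e = {(y # xs) ! j, (y # xs) ! Suc j}" "Suc j < length (y # xs)" by blast
      then show "e \<in> ?L"
      proof cases
        case 1
        then have "e = {(x # y # xs) ! 0, (x # y # xs) ! Suc 0}" by simp
        then show ?thesis by (intro CollectI exI[of _ 0]) simp
      next
        case (2 j)
        then show ?thesis by (intro CollectI exI[of _ "Suc j"]) simp
      qed
    qed
  qed
  with 1 show ?case by simp
qed auto

lemma path_edges_subset: "e \<in> path_edges xs \<Longrightarrow> e \<subseteq> set xs"
  by (induction xs rule: path_edges.induct) auto

lemma Union_path_edges: "2 \<le> length xs \<Longrightarrow> \<Union> (path_edges xs) = set xs"
proof (induction xs rule: path_edges.induct)
  case (1 x y xs)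
  then show ?case by (cases xs) auto
qed auto

text \<open>Replaces indices modulo the length by a path together with its closing edge, so that
  cycles can be cut and glued as lists.\<close>

lemma cycle_edges_conv:
  assumes "xs \<noteq> []"
  shows "cycle_edges xs = insert {last xs, hd xs} (path_edges xs)"
proof -
  let ?n = "length xs"
  have n: "?n > 0" using assms by simp
  have 1: "{xs ! i, xs ! ((i + 1) mod ?n)} = (if Suc i = ?n then {last xs, hd xs} else {xs ! i, xs ! Suc i})"
    if "i < ?n" for i
  proof (cases "Suc i = ?n")
    case True
    then have "last xs = xs ! i" using assms by (metis last_conv_nth diff_Suc_1)
    then show ?thesis using True assms by (simp add: hd_conv_nth)
  qed (use that in simp)
  show ?thesis
  proof
    show "cycle_edges xs \<subseteq> insert {last xs, hd xs} (path_edges xs)"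
    proof
      fix e assume "e \<in> cycle_edges xs"
      then obtain i where i: "i < ?n" "e = {xs ! i, xs ! ((i + 1) mod ?n)}"
        unfolding cycle_edges_def by blast
      show "e \<in> insert {last xs, hd xs} (path_edges xs)"
      proof (cases "Suc i = ?n")
        case False
        then have "Suc i < ?n" using i by simp
        then show ?thesis using 1[OF i(1)] i False unfolding path_edges_conv_nth by auto
      qed (use 1[OF i(1)] i in simp)
    qed
    show "insert {last xs, hd xs} (path_edges xs) \<subseteq> cycle_edges xs"
    proof
      fix e assume "e \<in> insert {last xs, hd xs} (path_edges xs)"
      then consider "e = {last xs, hd xs}" | j where "Suc j < ?n" "e = {xs ! j, xs ! Suc j}"
        unfolding path_edges_conv_nth by blast
      then show "e \<in> cycle_edges xs"
      proof cases
        case 1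
        then have "e = {xs ! (?n - 1), xs ! ((?n - 1 + 1) mod ?n)}"
          using n assms by (simp add: last_conv_nth hd_conv_nth)
        then show ?thesis using n unfolding cycle_edges_def
          by (intro CollectI exI[of _ "?n - 1"]) simp
      next
        case (2 j)
        then have "e = {xs ! j, xs ! ((j + 1) mod ?n)}" by simp
        then show ?thesis using 2 unfolding cycle_edges_def by (intro CollectI exI[of _ j]) simp
      qed
    qed
  qed
qed

lemma finite_cycle_edges [simp]: "finite (cycle_edges xs)"
  unfolding cycle_edges_def by simp

lemma Union_cycle_edges:
  assumes "xs \<noteq> []"
  shows "\<Union> (cycle_edges xs) = set xs"
proof (cases "length xs = 1")
  case True
  then show ?thesis by (auto simp: cycle_edges_conv length_Suc_conv)
next
  case False
  then have "2 \<le> length xs" using assms by (cases xs) (auto simp: Suc_le_eq)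
  then have "\<Union> (cycle_edges xs) = {last xs, hd xs} \<union> set xs"
    unfolding cycle_edges_conv[OF assms] by (simp add: Union_path_edges)
  then show ?thesis using assms by auto
qed

text \<open>\<open>link E x q y\<close>: the list \<open>q\<close> consists of the inner vertices of a path from \<open>x\<close> to \<open>y\<close>;
  the path has \<open>length q + 1\<close> edges.\<close>

definition link :: "'a set set \<Rightarrow> 'a \<Rightarrow> 'a list \<Rightarrow> 'a \<Rightarrow> bool" where
  "link E x q y \<longleftrightarrow> distinct (x # q @ [y]) \<and> path_edges (x # q @ [y]) \<subseteq> E"

lemma link_Nil [simp]: "link E x [] y \<longleftrightarrow> x \<noteq> y \<and> {x, y} \<in> E"
  by (auto simp: link_def)

lemma link_sym: "link E x q y \<Longrightarrow> link E y (rev q) x"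
  using path_edges_rev[of "x # q @ [y]"] by (auto simp: link_def)

text \<open>Cuts a path at an inner vertex \<open>a\<close>, or glues two paths there. The two links
  already keep \<open>a\<close> apart from the other vertices, so only the remaining parts have to
  be compared.\<close>

lemma link_append_iff:
  "link E x (p @ a # q) y \<longleftrightarrow>
     link E x p a \<and> link E a q y \<and> set (x # p) \<inter> set (q @ [y]) = {}"
proof -
  have "path_edges (x # (p @ a # q) @ [y]) = path_edges (x # p @ [a]) \<union> path_edges (a # q @ [y])"
    using path_edges_append[of "x # p" a "q @ [y]"] by simp
  then show ?thesis by (auto simp: link_def)
qed

lemma link_Cons_iff: "link E x (a # q) y \<longleftrightarrow> {x, a} \<in> E \<and> link E a q y \<and> x \<notin> set (a # q @ [y])"
  using link_append_iff[of E x "[]" a q y] by auto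

lemma link_snoc_iff: "link E x (q @ [a]) y \<longleftrightarrow> link E x q a \<and> {a, y} \<in> E \<and> y \<notin> set (x # q @ [a])"
  using link_append_iff[of E x q a "[]" y] by auto

lemma simple_graphE:
  assumes "simple_graph V E" "e \<in> E"
  obtains u v where "u \<noteq> v" "u \<in> V" "v \<in> V" "e = {u, v}"
  using assms unfolding simple_graph_def by meson

lemma simple_graph_Union: "simple_graph V E \<Longrightarrow> \<Union> E \<subseteq> V"
  by (auto elim!: simple_graphE)

lemma linked_subset:
  assumes "simple_graph V E" "link E x q y"
  shows "set (x # q @ [y]) \<subseteq> V"
proof -
  have "set (x # q @ [y]) = \<Union> (path_edges (x # q @ [y]))"
    using Union_path_edges[of "x # q @ [y]"] by simp
  then show ?thesis using assms(2) simple_graph_Union[OF assms(1)] unfolding link_def by blast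
qed

lemma cycle_edges_two_links:
  "cycle_edges (x # q @ y # rev p) = path_edges (x # q @ [y]) \<union> path_edges (x # p @ [y])"
proof -
  have 1: "path_edges (x # q @ y # rev p) = path_edges (x # q @ [y]) \<union> path_edges (y # rev p)"
    using path_edges_append[of "x # q" y "rev p"] by simp
  have "path_edges (x # p @ [y]) = path_edges (y # rev p @ [x])"
    using path_edges_rev[of "x # p @ [y]"] by simp
  also have "\<dots> = insert {last (y # rev p), x} (path_edges (y # rev p))"
    using path_edges_snoc[of "butlast (y # rev p)" "last (y # rev p)" x]
    by (metis append_butlast_last_id append_Cons append.assoc append_Nil list.distinct(1))
  finally show ?thesis using 1 by (auto simp: cycle_edges_conv)
qed

lemma is_cycle_two_links:
  assumes "simple_graph V E" "link E x q y" "link E x p y" "set q \<inter> set p = {}" "q \<noteq> [] \<or> p \<noteq> []"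
  shows "is_cycle V E (x # q @ y # rev p)"
  using linked_subset[OF assms(1,2)] linked_subset[OF assms(1,3)] assms(2-5)
  unfolding is_cycle_def cycle_edges_two_links link_def
  by (auto simp: Suc_le_eq numeral_3_eq_3 neq_Nil_conv)

text \<open>Two of the three cycles formed by the links are odd, and they share the link \<open>q\<close>.\<close>

lemma G_star_three_links:
  assumes sg: "simple_graph V E" and gs: "G_star V E"
    and l: "link E x p y" "link E x q y" "link E x r y"
    and disj: "set p \<inter> set q = {}" "set q \<inter> set r = {}" "set p \<inter> set r = {}"
    and ne: "p \<noteq> [] \<or> r \<noteq> []"
    and par: "even (length p) \<longleftrightarrow> even (length r)" "even (length q) \<longleftrightarrow> odd (length p)"
  shows "q = []"
proof (rule ccontr)
  assume q: "q \<noteq> []"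
  let ?C = "x # q @ y # rev p" and ?D = "x # q @ y # rev r"
  have "is_cycle V E ?C" using is_cycle_two_links[OF sg l(2,1)] disj q by blast
  then have C: "cycle_edges ?C \<in> odd_cycles V E" using par unfolding odd_cycles_def by fastforce
  have "is_cycle V E ?D" using is_cycle_two_links[OF sg l(2,3)] disj q by blast
  then have D: "cycle_edges ?D \<in> odd_cycles V E" using par unfolding odd_cycles_def by fastforce
  \<comment> \<open>The cycles are told apart by their vertex sets: \<open>p\<close> and
    \<open>r\<close> are disjoint and not both empty.\<close>
  have "\<Union> (cycle_edges ?C) \<noteq> \<Union> (cycle_edges ?D)"
    using disj l ne by (auto simp: Union_cycle_edges link_def neq_Nil_conv)
  then have "cycle_edges ?C \<noteq> cycle_edges ?D" by metis
  then have le: "card (cycle_edges ?C \<inter> cycle_edges ?D) \<le> 1"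
    using gs C D unfolding G_star_def by blast
  \<comment> \<open>A path with an inner vertex has a first and a last edge that differ, and both
    cycles contain them.\<close>
  obtain a q' where qa: "q = a # q'" using q by (cases q) auto
  obtain b q'' where qb: "q = q'' @ [b]" using q by (cases q rule: rev_cases) auto
  have e1: "{x, a} \<in> path_edges (x # q @ [y])" using qa by simp
  have e2: "{b, y} \<in> path_edges (x # q @ [y])" using qb path_edges_snoc[of "x # q''" b y] by simp
  have "{x, a} \<noteq> {b, y}" using l(2) qa qb unfolding link_def by (auto simp: doubleton_eq_iff)
  then have "card {{x, a}, {b, y}} = 2" by simp
  moreover have "{{x, a}, {b, y}} \<subseteq> cycle_edges ?C \<inter> cycle_edges ?D"
    using e1 e2 by (simp add: cycle_edges_two_links)
  ultimately have "2 \<le> card (cycle_edges ?C \<inter> cycle_edges ?D)"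
    by (metis card_mono finite_Int finite_cycle_edges)
  with le show False by simp
qed

lemma path_edges_append_nonempty:
  assumes "xs \<noteq> []" "ys \<noteq> []"
  shows "path_edges (xs @ ys) = insert {last xs, hd ys} (path_edges xs \<union> path_edges ys)"
proof -
  obtain xs' x where x: "xs = xs' @ [x]" using assms(1) by (cases xs rule: rev_cases) auto
  obtain y ys' where y: "ys = y # ys'" using assms(2) by (cases ys) auto
  show ?thesis using path_edges_append[of xs' x ys] x y by auto
qed

section \<open>Odd closed walks and ears\<close>

text \<open>A repeated vertex cuts the closed walk into two shorter closed walks, exactly one of
  which is odd; a walk without repetition is itself a cycle.\<close>

lemma odd_closed_walk_imp_odd_cycle:
  assumes sg: "simple_graph V E"
  shows "xs \<noteq> [] \<Longrightarrow> path_edges xs \<subseteq> E \<Longrightarrow> {last xs, hd xs} \<in> E \<Longrightarrow> odd (length xs) \<Longrightarrow>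
    \<exists>ys. is_cycle V E ys \<and> odd (length ys)"
proof (induction xs rule: length_induct)
  case (1 xs)
  have ce: "cycle_edges xs \<subseteq> E" using 1 by (simp add: cycle_edges_conv)
  show ?case
  proof (cases "distinct xs")
    case True
    have "set xs \<subseteq> V"
      using ce simple_graph_Union[OF sg] Union_cycle_edges[OF "1.prems"(1)] by blast
    \<comment> \<open>Length 1 would make the closing edge a loop, so an odd length is at least
      3.\<close>
    moreover have "length xs \<noteq> 1"
    proof
      assume "length xs = 1"
      then obtain x where "xs = [x]" by (auto simp: length_Suc_conv)
      then have "{x} \<in> E" using 1 by simp
      then show False using sg by (auto elim!: simple_graphE)
    qed
    then have "length xs \<ge> 3" using "1.prems"(4) by presburger
    ultimately show ?thesis using True ce "1.prems"(4) unfolding is_cycle_def by blast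
  next
    case False
    then obtain p a q r where xs: "xs = p @ [a] @ q @ [a] @ r" using not_distinct_decomp by blast
    have pe: "path_edges xs = path_edges (p @ [a]) \<union> path_edges (a # q @ [a]) \<union> path_edges (a # r)"
      using path_edges_append[of p a "q @ [a] @ r"] path_edges_append[of "a # q" a r]
      unfolding xs by auto
    \<comment> \<open>The two closed walks are \<open>a # q\<close> and \<open>p @ a # r\<close>;
      their lengths add up to that of \<open>xs\<close>.\<close>
    show ?thesis
    proof (cases "odd (length (a # q))")
      case True
      have "path_edges (a # q @ [a]) = insert {last (a # q), a} (path_edges (a # q))"
        using path_edges_append_nonempty[of "a # q" "[a]"] by simp
      then have "path_edges (a # q) \<subseteq> E" "{last (a # q), hd (a # q)} \<in> E"
        using pe "1.prems"(2) by auto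
      moreover have "length (a # q) < length xs" using xs by simp
      ultimately show ?thesis using "1.IH" True by blast
    next
      case False
      let ?ys = "p @ a # r"
      have "path_edges ?ys \<subseteq> E" using pe "1.prems"(2) path_edges_append[of p a r] by auto
      moreover have "last ?ys = last xs" "hd ?ys = hd xs" using xs by (simp_all add: hd_append)
      moreover have "length ?ys < length xs" using xs by simp
      moreover have "odd (length ?ys)" using xs False "1.prems"(4) by simp
      ultimately show ?thesis using "1.IH" "1.prems"(3) by (metis append_is_Nil_conv list.distinct(1))
    qed
  qed
qed

text \<open>Without odd cycles, the parity of walks from a fixed root is a well-defined proper
  2-colouring.\<close>

lemma nonbipartite_imp_odd_cycle:
  assumes sg: "simple_graph V E" and con: "connected V E" and nb: "\<not> bipartite V E"
  shows "\<exists>ys. is_cycle V E ys \<and> odd (length ys)"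
proof (rule ccontr)
  assume no: "\<not> ?thesis"
  obtain r where r: "r \<in> V" using con unfolding connected_def by blast
  \<comment> \<open>The list \<open>w\<close> holds the vertices before \<open>v\<close>, so
    \<open>length w\<close> counts the edges of a walk from \<open>r\<close> to \<open>v\<close>;
    \<open>b\<close> says whether that number is even.\<close>
  define W where "W b v \<longleftrightarrow> (\<exists>w. hd (w @ [v]) = r \<and> path_edges (w @ [v]) \<subseteq> E \<and> even (length w) = b)"
    for b v
  have W_flip: "W (\<not> b) v" if W: "W b u" and uv: "{u, v} \<in> E" for b u v
  proof -
    obtain w where w: "hd (w @ [u]) = r" "path_edges (w @ [u]) \<subseteq> E" "even (length w) = b"
      using W unfolding W_def by blast
    then have "hd ((w @ [u]) @ [v]) = r" by (cases w) auto
    moreover have "path_edges ((w @ [u]) @ [v]) \<subseteq> E" using w uv path_edges_snoc[of w u v] by simp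
    ultimately show ?thesis using w(3) unfolding W_def by (metis even_Suc length_append_singleton)
  qed
  have ex: "W True v \<or> W False v" if "v \<in> V" for v
  proof -
    have "(r, v) \<in> {(x, y). {x, y} \<in> E \<and> x \<in> V \<and> y \<in> V}\<^sup>*"
      using con r that unfolding connected_def by blast
    then show ?thesis
    proof (induction rule: rtrancl_induct)
      case base
      have "W True r" unfolding W_def by (rule exI[of _ "[]"]) simp
      then show ?case by simp
    next
      case (step y z)
      then show ?case using W_flip[of True y z] W_flip[of False y z] by auto
    qed
  qed
  have excl: "\<not> (W True v \<and> W False v)" for v
  proof
    assume "W True v \<and> W False v"
    then obtain w1 w2 where w1: "hd (w1 @ [v]) = r" "path_edges (w1 @ [v]) \<subseteq> E" "even (length w1)"
      and w2: "hd (w2 @ [v]) = r" "path_edges (w2 @ [v]) \<subseteq> E" "odd (length w2)"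
      unfolding W_def by auto
    \<comment> \<open>Going out along \<open>w1\<close> and back along \<open>w2\<close> gives an
      odd closed walk. The final \<open>r\<close> is dropped, because the closing edge returns to
      it.\<close>
    obtain w2' where w2': "w2 = r # w2'" using w2 by (cases w2) auto
    let ?c = "w1 @ v # rev w2'"
    have "path_edges (v # rev w2) = path_edges (w2 @ [v])" using path_edges_rev[of "w2 @ [v]"] by simp
    then have "path_edges (?c @ [r]) \<subseteq> E"
      using w1 w2 w2' path_edges_append[of w1 v "rev w2' @ [r]"] by auto
    then have "path_edges ?c \<subseteq> E" "{last ?c, r} \<in> E"
      using path_edges_append_nonempty[of ?c "[r]"] by auto
    moreover have "hd ?c = r" using w1(1) by (cases w1) auto
    moreover have "odd (length ?c)" using w1(3) w2(3) w2' by simp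
    ultimately have "\<exists>ys. is_cycle V E ys \<and> odd (length ys)"
      using odd_closed_walk_imp_odd_cycle[OF sg, of ?c] by simp
    with no show False by blast
  qed
  have "bipartite V E" unfolding bipartite_def
  proof (intro exI[of _ "{v \<in> V. W True v}"] conjI ballI)
    fix e assume e: "e \<in> E"
    then obtain u v where uv: "u \<in> V" "v \<in> V" "e = {u, v}" by (rule simple_graphE[OF sg])
    consider "W True u" | "W False u" using ex uv by blast
    then show "\<exists>u v. e = {u, v} \<and> u \<in> {v \<in> V. W True v} \<and> v \<in> V - {v \<in> V. W True v}"
    proof cases
      case 1
      then have "W False v" using W_flip[of True u v] e uv by simp
      then show ?thesis using 1 uv excl[of v] by (intro exI[of _ u] exI[of _ v]) simp
    next
      case 2
      then have "W True v" using W_flip[of False u v] e uv by simp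
      then show ?thesis using 2 uv excl[of u] by (intro exI[of _ v] exI[of _ u]) (simp add: insert_commute)
    qed
  qed simp
  with nb show False by simp
qed

section \<open>Existence of ears in 2-connected graphs\<close>

lemma link_mono: "link E x q y \<Longrightarrow> E \<subseteq> E' \<Longrightarrow> link E' x q y"
  unfolding link_def by blast

text \<open>Yields the part of a walk up to its first vertex in \<open>U\<close>, made into a path:
  vertices are put in front one at a time, and a vertex that already lies on the path replaces it by
  the part that starts there.\<close>

lemma link_to_set:
  assumes "(v, w) \<in> {(x, y). {x, y} \<in> E \<and> x \<in> V \<and> y \<in> V}\<^sup>*" "w \<in> U" "v \<notin> U"
  shows "\<exists>q b. link E v q b \<and> set (v # q) \<inter> U = {} \<and> b \<in> U"
  using assms
proof (induction rule: converse_rtrancl_induct)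
  case (step v v')
  then have e: "{v, v'} \<in> E" by simp
  show ?case
  proof (cases "v' \<in> U")
    case True
    then show ?thesis using e step.prems by (intro exI[of _ "[]"] exI[of _ v']) auto
  next
    case False
    then obtain q b where q: "link E v' q b" "set (v' # q) \<inter> U = {}" "b \<in> U"
      using step by blast
    show ?thesis
    proof (cases "v \<in> set (v' # q)")
      case True
      then consider "v = v'" | s t where "q = s @ v # t" using split_list by fastforce
      then show ?thesis
      proof cases
        case (2 s t)
        then have "link E v t b" using q(1) link_append_iff by metis
        then show ?thesis using q 2 by (intro exI[of _ t] exI[of _ b]) auto
      qed (use q in blast)
    next
      case False
      have "v \<noteq> b" using q step.prems by auto
      then have "link E v (v' # q) b" using False q e by (auto simp: link_Cons_iff)
      then show ?thesis using q step.prems by (intro exI[of _ "v' # q"] exI[of _ b]) auto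
    qed
  qed
qed simp

text \<open>If all vertices are covered, a missing edge is the ear. Otherwise a path from an
  uncovered vertex first meets \<open>U\<close> in some \<open>u\<close>, and deleting
  \<open>u\<close> leaves a path from there to a second vertex of \<open>U\<close>.\<close>

lemma ear_exists:
  assumes sg: "simple_graph V E" and tc: "two_connected V E" and U: "U \<subseteq> V" "F \<subseteq> E"
    and ab: "a \<in> U" "b \<in> U" "a \<noteq> b" and proper: "U \<noteq> V \<or> F \<noteq> E"
  obtains c q d where "c \<in> U" "d \<in> U" "link E c q d" "set q \<inter> U = {}" "q = [] \<Longrightarrow> {c, d} \<notin> F"
proof (cases "U = V")
  case True
  then obtain e where e: "e \<in> E" "e \<notin> F" using proper U by blast
  then obtain u v where "u \<noteq> v" "u \<in> V" "v \<in> V" "e = {u, v}" using simple_graphE[OF sg] by metis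
  then show ?thesis using that[of u v "[]"] e True by simp
next
  case False
  then obtain v0 where v0: "v0 \<in> V" "v0 \<notin> U" using U by blast
  have "(v0, a) \<in> {(x, y). {x, y} \<in> E \<and> x \<in> V \<and> y \<in> V}\<^sup>*"
    using tc v0 ab U unfolding two_connected_def connected_def by blast
  then obtain q0 u where q0: "link E v0 q0 u" "set (v0 # q0) \<inter> U = {}" "u \<in> U"
    using link_to_set[of v0 a E V U] v0 ab by blast
  \<comment> \<open>The neighbour of \<open>u\<close> outside \<open>U\<close> from which the second
    half of the ear starts.\<close>
  define v where "v = last (v0 # q0)"
  have vU: "v \<notin> U" using q0(2) last_in_set[of "v0 # q0"] unfolding v_def by blast
  have uv: "{u, v} \<in> E" "v \<in> V"
    using q0(1) path_edges_append_nonempty[of "v0 # q0" "[u]"] linked_subset[OF sg q0(1)]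
      last_in_set[of "v0 # q0"]
    unfolding v_def link_def by (auto simp: insert_commute)
  obtain w where w: "w \<in> U" "w \<noteq> u" using ab by metis
  let ?E = "{e \<in> E. u \<notin> e}"
  have "connected (V - {u}) ?E" using tc q0(3) U unfolding two_connected_def by blast
  then have "(v, w) \<in> {(x, y). {x, y} \<in> ?E \<and> x \<in> V - {u} \<and> y \<in> V - {u}}\<^sup>*"
    using w vU uv q0(3) U unfolding connected_def by blast
  then obtain q d where q: "link ?E v q d" "set (v # q) \<inter> U = {}" "d \<in> U"
    using link_to_set[of v w ?E "V - {u}" U] w vU by blast
  have "set (v # q @ [d]) = \<Union> (path_edges (v # q @ [d]))" by (subst Union_path_edges) auto
  then have "u \<notin> set (v # q @ [d])" using q(1) unfolding link_def by blast
  moreover have "link E v q d" using q(1) by (rule link_mono) blast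
  ultimately have "link E u (v # q) d" using uv by (simp add: link_Cons_iff)
  then show ?thesis using that[of u d "v # q"] q q0 by simp
qed

section \<open>Theta subgraphs and their ears\<close>

text \<open>The links \<open>m\<close> and \<open>n\<close> form an odd cycle, so their parities
  differ and \<open>p\<close> agrees with one of them. The one left over must be a single edge; it
  cannot be \<open>n\<close>, hence it is \<open>m\<close>.\<close>

lemma G_star_ear_of_odd_cycle:
  assumes sg: "simple_graph V E" and gs: "G_star V E"
    and l: "link E a m b" "link E b n a" "link E a p b"
    and disj: "set m \<inter> set n = {}" "set p \<inter> set m = {}" "set p \<inter> set n = {}"
    and odd: "odd (length m + length n)" and n: "n \<noteq> []" and pm: "p \<noteq> [] \<or> m \<noteq> []"
  shows "m = [] \<and> odd (length n) \<and> odd (length p)"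
proof -
  note n' = link_sym[OF l(2)]
  have "even (length p) \<noteq> even (length m)"
  proof
    assume "even (length p) = even (length m)"
    then have "rev n = []"
      using G_star_three_links[OF sg gs l(3) n' l(1)] disj odd pm by auto
    with n show False by simp
  qed
  then have par: "even (length p) \<longleftrightarrow> even (length n)" "even (length m) \<longleftrightarrow> odd (length p)"
    using odd by auto
  have "m = []" by (rule G_star_three_links[OF sg gs l(3) l(1) n']) (use disj par n in auto)
  with par show ?thesis by simp
qed

text \<open>The lists \<open>Qs\<close> are the inner vertices of the paths of even length joining the
  ends of the edge \<open>x y\<close>.\<close>

definition even_theta :: "'a set set \<Rightarrow> 'a \<Rightarrow> 'a \<Rightarrow> 'a list list \<Rightarrow> bool" where
  "even_theta E x y Qs \<longleftrightarrow> {x, y} \<in> E \<and> distinct (x # y # concat Qs) \<and>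
     (\<forall>q\<in>set Qs. odd (length q) \<and> link E x q y)"

definition span_verts :: "'a \<Rightarrow> 'a \<Rightarrow> 'a list list \<Rightarrow> 'a set" where
  "span_verts x y Qs = {x, y} \<union> set (concat Qs)"

definition span_edges :: "'a \<Rightarrow> 'a \<Rightarrow> 'a list list \<Rightarrow> 'a set set" where
  "span_edges x y Qs = insert {x, y} (\<Union>q\<in>set Qs. path_edges (x # q @ [y]))"

lemma list_hd_lastE:
  assumes "zs \<noteq> []" "hd zs \<noteq> last zs"
  obtains q where "zs = hd zs # q @ [last zs]"
proof -
  obtain z zs' where z: "zs = z # zs'" using assms by (cases zs) auto
  then show ?thesis using assms that by (cases zs' rule: rev_cases) auto
qed

text \<open>The pieces \<open>s\<close>, \<open>m\<close>, \<open>t\<close> are what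
  \<open>a\<close> and \<open>b\<close> cut out of one path. An ear between \<open>x\<close> and
  \<open>y\<close> would be a further path of even length. Any other ear is an ear of the odd cycle
  formed by this path and the edge \<open>x y\<close>, so it runs parallel to an edge
  \<open>a b\<close> and changes the parity of the path when it replaces that edge.\<close>

lemma even_theta_ear_same_path:
  assumes sg: "simple_graph V E" and gs: "G_star V E" and th: "even_theta E x y Qs"
    and max: "\<And>x y Rs. even_theta E x y Rs \<Longrightarrow> length Rs \<le> length Qs"
    and q: "q \<in> set Qs" "x # q @ [y] = s @ a # m @ b # t"
    and p: "link E a p b" "set p \<inter> span_verts x y Qs = {}" "p = [] \<Longrightarrow> {a, b} \<notin> span_edges x y Qs"
  shows False
proof -
  have xy: "{x, y} \<in> E" "x \<noteq> y" and qs: "odd (length q)" "link E x q y"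
    and dist: "distinct (concat Qs)"
    using th q unfolding even_theta_def by auto
  have sub: "set (x # q @ [y]) \<subseteq> span_verts x y Qs" using q(1) unfolding span_verts_def by auto
  have set_eq: "set (x # q @ [y]) = set (s @ a # m @ b # t)" using q(2) by simp
  have d: "distinct (s @ a # m @ b # t)" using qs(2) q(2) unfolding link_def by simp
  have len: "length q + 2 = length s + length m + length t + 2"
    using arg_cong[OF q(2), of length] by simp
  have pe: "path_edges (x # q @ [y]) = path_edges (s @ [a]) \<union> path_edges (a # m @ [b]) \<union> path_edges (b # t)"
    using path_edges_append[of s a "m @ b # t"] path_edges_append[of "a # m" b t]
    unfolding q(2) by auto
  have peE: "path_edges (x # q @ [y]) \<subseteq> E" using qs(2) unfolding link_def by simp
  have pd: "set p \<inter> set (s @ a # m @ b # t) = {}" using p(2) sub unfolding set_eq by blast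
  show False
  proof (cases "s = [] \<and> t = []")
    case True
    then have ab: "a = x" "b = y" using q(2) by auto
    have pne: "p \<noteq> []" using p(3) ab unfolding span_edges_def by auto
    \<comment> \<open>Otherwise \<open>p\<close> and the edge \<open>x y\<close> have equal parity
      and \<open>q\<close> would have to be a single edge.\<close>
    have "odd (length p)"
    proof
      assume "even (length p)"
      then have "q = []"
        using G_star_three_links[OF sg gs, of x p y q "[]"] p(1,2) sub pne qs xy ab by auto
      with qs show False by simp
    qed
    moreover have "set p \<inter> set (concat Qs) = {}" "x \<notin> set p" "y \<notin> set p" "distinct p"
      using p(1,2) ab unfolding span_verts_def link_def by auto
    ultimately have "even_theta E x y (p # Qs)"
      using th p(1) ab unfolding even_theta_def by auto
    then show False using max[of x y "p # Qs"] by simp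
  next
    case False
    have "last (b # t) = y" "hd (s @ [a]) = x"
      using arg_cong[OF q(2), of last] arg_cong[OF q(2), of hd] by (simp_all add: hd_append split: if_splits)
    \<comment> \<open>The other side of the odd cycle: from \<open>b\<close> along \<open>t\<close>
      to \<open>y\<close>, over the edge \<open>x y\<close> to \<open>x\<close>, and along
      \<open>s\<close> to \<open>a\<close>.\<close>
    then have "path_edges (b # t @ s @ [a]) \<subseteq> E"
      using path_edges_append_nonempty[of "b # t" "s @ [a]"] pe peE xy by (auto simp: insert_commute)
    then have n: "link E b (t @ s) a" using d unfolding link_def by auto
    have m: "link E a m b" using pe peE d unfolding link_def by auto
    have pm: "p \<noteq> [] \<or> m \<noteq> []"
    proof (rule ccontr)
      assume "\<not> ?thesis"
      then have "{a, b} \<in> path_edges (x # q @ [y])" "p = []" using pe by auto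
      with p(3) q(1) show False unfolding span_edges_def by auto
    qed
    have r: "m = [] \<and> odd (length (t @ s)) \<and> odd (length p)"
      using G_star_ear_of_odd_cycle[OF sg gs m n p(1)] pm False d pd len qs(1) by auto
    have ab: "{a, b} \<in> E" "a \<noteq> b" using m r by auto
    show False
    proof (cases "\<exists>q'\<in>set Qs. q' \<noteq> q")
      case False
      have "length Qs \<le> 1"
      proof (rule ccontr)
        assume "\<not> ?thesis"
        then obtain q1 q2 Qs' where Qs: "Qs = q1 # q2 # Qs'" by (cases Qs; cases "tl Qs") auto
        then have "q1 = q" "q2 = q" using False by auto
        then show False using dist qs(1) Qs by (cases q) auto
      qed
      \<comment> \<open>With a single path in \<open>Qs\<close>, moving the base edge to
        \<open>a b\<close> gives two paths of even length and contradicts maximality.\<close>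
      moreover have "even_theta E a b [rev (t @ s), p]"
        using r ab link_sym[OF n] p(1) d pd unfolding even_theta_def link_def by auto
      ultimately show False using max[of a b "[rev (t @ s), p]"] by simp
    next
      case True
      then obtain q' where q': "q' \<in> set Qs" "q' \<noteq> q" by blast
      have q'l: "odd (length q')" "link E x q' y" using th q' unfolding even_theta_def by auto
      have q'q: "set q' \<inter> set q = {}" using dist q' q(1) by (auto simp: distinct_concat_iff)
      have q'p: "set q' \<inter> set p = {}" using p(2) q' unfolding span_verts_def by auto
      have "hd (s @ a # p @ b # t) = x" "last (s @ a # p @ b # t) = y"
        using \<open>last (b # t) = y\<close> \<open>hd (s @ [a]) = x\<close> by (simp_all add: hd_append split: if_splits)
      \<comment> \<open>The path rerouted through the ear has odd length, like the edge
        \<open>x y\<close>, so a second path \<open>q'\<close> of even length would have to be a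
        single edge.\<close>
      then obtain q'' where q'': "s @ a # p @ b # t = x # q'' @ [y]"
        using list_hd_lastE[of "s @ a # p @ b # t"] xy(2) by (metis append_is_Nil_conv list.distinct(1))
      have "path_edges (s @ a # p @ b # t)
          = path_edges (s @ [a]) \<union> path_edges (a # p @ [b]) \<union> path_edges (b # t)"
        using path_edges_append[of s a "p @ b # t"] path_edges_append[of "a # p" b t] by auto
      then have "path_edges (x # q'' @ [y]) \<subseteq> E"
        using pe peE p(1) unfolding q''[symmetric] link_def by auto
      moreover have "distinct (x # q'' @ [y])"
        using d pd p(1) unfolding q''[symmetric] link_def by auto
      ultimately have l'': "link E x q'' y" unfolding link_def by simp
      have len'': "length q'' + 2 = length s + length p + length t + 2"
        using arg_cong[OF q'', of length] by simp
      have "set (x # q'' @ [y]) = set (s @ a # p @ b # t)" using q'' by simp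
      also have "\<dots> \<subseteq> set (s @ a # m @ b # t) \<union> set p" by auto
      also have "\<dots> = set (x # q @ [y]) \<union> set p" unfolding set_eq ..
      finally have "set q'' \<subseteq> set q \<union> set p \<union> {x, y}" by auto
      then have disj: "set q'' \<inter> set q' = {}" using q'q q'p q'l unfolding link_def by auto
      have "q'' \<noteq> []" using len'' False by auto
      then have "q' = []"
        using G_star_three_links[OF sg gs l'' q'l(2), of "[]"] xy disj len'' r q'l(1) by auto
      then show False using q'l by simp
    qed
  qed
qed

text \<open>Three paths lead from \<open>a\<close> to \<open>x\<close>: back along
  \<open>a1\<close>, forward along \<open>a2\<close> and over the edge \<open>x y\<close>, and
  across \<open>p\<close> and along \<open>b1\<close>. The first two differ in parity, and the
  second is never a single edge, so the first is the exceptional one.\<close>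

lemma G_star_cross_ear:
  assumes sg: "simple_graph V E" and gs: "G_star V E" and xy: "x \<noteq> y" "{x, y} \<in> E"
    and q: "link E x (a1 @ a # a2) y" "link E x (b1 @ b # b2) y" "even (length a1 + length a2)"
    and disj: "set (a1 @ a # a2) \<inter> set (b1 @ b # b2) = {}"
    and p: "link E a p b" "set p \<inter> ({x, y} \<union> set (a1 @ a # a2) \<union> set (b1 @ b # b2)) = {}"
  shows "a1 = [] \<and> even (length p + length b1)"
proof -
  have l: "link E x a1 a" "link E a a2 y" "link E x b1 b"
    using q unfolding link_append_iff by auto
  have l1: "link E a (rev a1) x" using l(1) by (rule link_sym)
  have l2: "link E a (a2 @ [y]) x"
  proof -
    have "x \<notin> set (a # a2 @ [y])" using q(1) unfolding link_def by auto
    then show ?thesis using l(2) xy by (simp add: link_snoc_iff insert_commute)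
  qed
  have l3: "link E a (p @ b # rev b1) x"
    using p q disj link_sym[OF l(3)] unfolding link_append_iff by (auto simp: link_def)
  have d: "set (rev a1) \<inter> set (a2 @ [y]) = {}" "set (rev a1) \<inter> set (p @ b # rev b1) = {}"
    "set (a2 @ [y]) \<inter> set (p @ b # rev b1) = {}"
    using p q disj unfolding link_def by auto
  have "even (length a1) = odd (length (p @ b # rev b1))"
    using G_star_three_links[OF sg gs l1 l2 l3] d q(3) by auto
  moreover from this have "rev a1 = []"
    using G_star_three_links[OF sg gs l2 l1 l3] d q(3) by auto
  ultimately show ?thesis by auto
qed

text \<open>Inside the \<open>K\<^sub>4\<close> there are paths of lengths 1, 2 and 3 between
  \<open>x\<close> and \<open>y\<close>. An ear of odd length, with the edge, isolates the path of
  length 2; an ear of even length is itself isolated by those of lengths 1 and 3.\<close>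

lemma G_star_K4_no_ear:
  assumes sg: "simple_graph V E" and gs: "G_star V E" and d: "distinct [x, y, z, w]"
    and e: "{x, y} \<in> E" "{x, z} \<in> E" "{x, w} \<in> E" "{y, z} \<in> E" "{y, w} \<in> E" "{z, w} \<in> E"
    and p: "link E x p y" "set p \<inter> {x, y, z, w} = {}"
  shows "p = []"
proof (rule ccontr)
  assume ne: "p \<noteq> []"
  have l: "link E x [] y" "link E x [z] y" "link E x [z, w] y"
    using d e by (auto simp: link_Cons_iff insert_commute)
  have "odd (length p)"
    using G_star_three_links[OF sg gs p(1) l(2,1)] ne p(2) by auto
  then show False
    using G_star_three_links[OF sg gs l(1) p(1) l(3)] ne p(2) by auto
qed

section \<open>Isomorphisms\<close>

text \<open>Allows an isomorphism to be described by a map out of the model graph and the image of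
  its edge set. The isomorphism is the inverse map. Taking images is injective on subsets of
  \<open>W\<close>, which is why \<open>F\<close> has to consist of such sets.\<close>

lemma graph_iso_of_image:
  assumes g: "bij_betw g W V" and F: "\<And>e. e \<in> F \<Longrightarrow> e \<subseteq> W" and E: "(`) g ` F = E"
  shows "graph_iso V E W F"
  unfolding graph_iso_def
proof (intro exI[of _ "inv_into W g"] conjI ballI)
  show "bij_betw (inv_into W g) V W" using g by (rule bij_betw_inv_into)
  fix u v assume uv: "u \<in> V" "v \<in> V"
  let ?e = "{inv_into W g u, inv_into W g v}"
  have "g ` ?e = {u, v}" using uv g by (simp add: bij_betw_inv_into_right)
  moreover have "?e \<subseteq> W" using uv g by (auto simp: bij_betw_def inv_into_into)
  moreover have "inj_on ((`) g) (Pow W)" using g by (simp add: bij_betw_def inj_on_image_Pow)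
  ultimately have "{u, v} \<in> (`) g ` F \<longleftrightarrow> ?e \<in> F"
    using inj_on_image_mem_iff[of "(`) g" "Pow W" ?e F] F by (auto simp: subset_iff)
  then show "{u, v} \<in> E \<longleftrightarrow> ?e \<in> F" using E by simp
qed

definition all_edges :: "'a set \<Rightarrow> 'a set set" where
  "all_edges U = {{u, v} | u v. u \<in> U \<and> v \<in> U \<and> u \<noteq> v}"

lemma image_all_edges:
  assumes "inj_on g U"
  shows "(`) g ` all_edges U = all_edges (g ` U)"
proof
  show "(`) g ` all_edges U \<subseteq> all_edges (g ` U)"
    using assms unfolding all_edges_def by (fastforce simp: inj_on_eq_iff)
  show "all_edges (g ` U) \<subseteq> (`) g ` all_edges U"
  proof
    fix e assume "e \<in> all_edges (g ` U)"
    then obtain u v where uv: "u \<in> U" "v \<in> U" "g u \<noteq> g v" "e = {g u, g v}"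
      unfolding all_edges_def by auto
    then have "{u, v} \<in> all_edges U" unfolding all_edges_def by auto
    then show "e \<in> (`) g ` all_edges U" using uv by (intro image_eqI[of _ _ "{u, v}"]) auto
  qed
qed

lemma K4_edges_conv: "K4_edges = all_edges K4_verts"
  unfolding K4_edges_def all_edges_def K4_verts_def by simp

lemma card_4_graph_iso_K4:
  assumes "card U = 4"
  shows "graph_iso U (all_edges U) K4_verts K4_edges"
proof -
  have "finite U" using assms by (metis card.infinite zero_neq_numeral)
  then obtain g where g: "bij_betw g K4_verts U"
    using finite_same_card_bij[of K4_verts U] assms unfolding K4_verts_def by auto
  show ?thesis
  proof (rule graph_iso_of_image[OF g])
    show "e \<subseteq> K4_verts" if "e \<in> K4_edges" for e
      using that unfolding K4_edges_conv all_edges_def by auto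
    show "(`) g ` K4_edges = all_edges U"
      using g image_all_edges[of g K4_verts] unfolding K4_edges_conv bij_betw_def by simp
  qed
qed

text \<open>An ear with inner vertices is excluded by \<open>G_star_K4_no_ear\<close>, whichever two
  vertices it joins, and an ear without them is already an edge of the complete graph.\<close>

lemma G_star_K4_spanning:
  assumes sg: "simple_graph V E" and gs: "G_star V E" and tc: "two_connected V E"
    and U: "U \<subseteq> V" "card U = 4" "all_edges U \<subseteq> E"
  shows "V = U \<and> E = all_edges U"
proof (rule ccontr)
  assume "\<not> ?thesis"
  then have proper: "U \<noteq> V \<or> all_edges U \<noteq> E" by auto
  have fin: "finite U" using U by (metis card.infinite zero_neq_numeral)
  obtain a b where ab: "a \<in> U" "b \<in> U" "a \<noteq> b"
    using U(2) by (metis card_le_Suc0_iff_eq fin numeral_le_one_iff One_nat_def semiring_norm(69))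
  obtain x q y where q: "x \<in> U" "y \<in> U" "link E x q y" "set q \<inter> U = {}" "q = [] \<Longrightarrow> {x, y} \<notin> all_edges U"
    using ear_exists[OF sg tc U(1,3) ab proper] by metis
  have xy: "x \<noteq> y" using q(3) unfolding link_def by auto
  then have "card (U - {x, y}) = 2" using q U(2) fin by (simp add: card_Diff_subset)
  then obtain z w where zw: "U - {x, y} = {z, w}" "z \<noteq> w" by (meson card_2_iff)
  then have mem: "z \<in> U" "w \<in> U" "z \<noteq> x" "z \<noteq> y" "w \<noteq> x" "w \<noteq> y" by auto
  have E: "{u, v} \<in> E" if "u \<in> U" "v \<in> U" "u \<noteq> v" for u v
    using that U(3) unfolding all_edges_def by auto
  have "q = []"
    using G_star_K4_no_ear[OF sg gs, of x y z w q] xy mem zw(2) E q by auto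
  moreover have "{x, y} \<in> all_edges U" using xy q unfolding all_edges_def by auto
  ultimately show False using q(5) by simp
qed

lemma distinct_concat_nth_disjoint:
  "distinct (concat Qs) \<Longrightarrow> k < length Qs \<Longrightarrow> k' < length Qs \<Longrightarrow> k \<noteq> k' \<Longrightarrow>
    set (Qs ! k) \<inter> set (Qs ! k') = {}"
proof (induction Qs arbitrary: k k')
  case (Cons q Qs)
  have "set q \<inter> set (Qs ! i) = {}" if "i < length Qs" for i
    using Cons.prems(1) nth_mem[OF that] by auto
  then show ?case using Cons by (cases k; cases k') auto
qed simp

lemma even_theta_imp_graph_iso:
  assumes th: "even_theta E x y Qs"
  defines "ps \<equiv> map (\<lambda>q. length q + 1) Qs"
  shows "graph_iso (span_verts x y Qs) (span_edges x y Qs) (theta_verts (1 # ps)) (theta_edges (1 # ps))"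
proof -
  \<comment> \<open>In \<open>1 # ps\<close> the base edge has index 0, so path \<open>k\<close> of
    \<open>Qs\<close> has index \<open>k + 1\<close> and its inner vertices have first coordinate
    \<open>k + 2\<close>; their second coordinate counts from 1.\<close>
  define g where "g = (\<lambda>(i, j). if i = 0 then (if j = 0 then x else y) else Qs ! (i - 2) ! (j - 1))"
  have g0: "g (0, 0) = x" "g (0, Suc 0) = y" and gS: "g (Suc (Suc k), Suc j) = Qs ! k ! j" for k j
    unfolding g_def by auto
  have dist: "distinct (concat Qs)" "x \<noteq> y" "x \<notin> set (concat Qs)" "y \<notin> set (concat Qs)"
    using th unfolding even_theta_def by auto
  have mem: "Qs ! k ! j \<in> set (concat Qs)" if "k < length Qs" "j < length (Qs ! k)" for k j
    using nth_mem[OF that(1)] nth_mem[OF that(2)] by auto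
  define I where "I = {(Suc (Suc k), Suc j) | k j. k < length Qs \<and> j < length (Qs ! k)}"
  have W: "theta_verts (1 # ps) = {(0, 0), (0, Suc 0)} \<union> I"
  proof -
    have "{(i + 1, j) | i j. i < length (1 # ps) \<and> 0 < j \<and> j < (1 # ps) ! i} = I" (is "?L = I")
    proof
      show "?L \<subseteq> I"
      proof
        fix z assume "z \<in> ?L"
        then obtain i j where z: "z = (i + 1, j)" "i < length (1 # ps)" "0 < j" "j < (1 # ps) ! i" by blast
        then obtain k where "i = Suc k" by (cases i) auto
        moreover obtain j' where "j = Suc j'" using z(3) by (cases j) auto
        ultimately show "z \<in> I" using z unfolding I_def ps_def by auto
      qed
      show "I \<subseteq> ?L"
        unfolding I_def ps_def by auto
    qed
    then show ?thesis unfolding theta_verts_def by simp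
  qed
  have inj_idx: "k = k' \<and> j = j'"
    if "k < length Qs" "j < length (Qs ! k)" "k' < length Qs" "j' < length (Qs ! k')"
      "Qs ! k ! j = Qs ! k' ! j'" for k j k' j'
  proof -
    have "k = k'"
    proof (rule ccontr)
      assume "k \<noteq> k'"
      then have "set (Qs ! k) \<inter> set (Qs ! k') = {}"
        using distinct_concat_nth_disjoint[OF dist(1)] that by simp
      then show False using that by (metis disjoint_iff nth_mem)
    qed
    moreover have "distinct (Qs ! k)" using dist(1) that by (simp add: distinct_concat_iff)
    ultimately show ?thesis using that by (simp add: nth_eq_iff_index_eq)
  qed
  have inj: "inj_on g (theta_verts (1 # ps))"
    unfolding W
  proof (rule inj_onI)
    fix z z' assume z: "z \<in> {(0, 0), (0, Suc 0)} \<union> I" "z' \<in> {(0, 0), (0, Suc 0)} \<union> I" "g z = g z'"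
    then show "z = z'" using dist(2-4) mem inj_idx unfolding I_def by (auto simp: g0 gS) metis+
  qed
  have img: "g ` theta_verts (1 # ps) = span_verts x y Qs"
  proof -
    have "g ` I = set (concat Qs)"
    proof
      show "g ` I \<subseteq> set (concat Qs)" unfolding I_def using mem by (auto simp: gS)
      show "set (concat Qs) \<subseteq> g ` I"
      proof
        fix v assume "v \<in> set (concat Qs)"
        then obtain q where q: "q \<in> set Qs" "v \<in> set q" by auto
        then obtain k j where k: "k < length Qs" "Qs ! k = q" "j < length q" "q ! j = v"
          by (meson in_set_conv_nth)
        then show "v \<in> g ` I" unfolding I_def
          by (intro image_eqI[of _ _ "(Suc (Suc k), Suc j)"]) (auto simp: gS)
      qed
    qed
    then show ?thesis unfolding W span_verts_def by (simp add: g0)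
  qed
  \<comment> \<open>Positions on a theta path and in \<open>x # q @ [y]\<close> agree, including
    both ends, so edges correspond index by index.\<close>
  have gtv: "g (theta_vertex (1 # ps) (Suc k) j) = (x # Qs ! k @ [y]) ! j"
    if "k < length Qs" "j \<le> length (Qs ! k) + 1" for k j
    using that by (cases j) (auto simp: theta_vertex_def ps_def g0 gS nth_append)
  have tv: "theta_vertex (1 # ps) i j \<in> theta_verts (1 # ps)"
    if "i < length (1 # ps)" "j \<le> (1 # ps) ! i" for i j
    using that unfolding theta_vertex_def theta_verts_def by auto
  have edges: "(`) g ` theta_edges (1 # ps) = span_edges x y Qs"
  proof
    show "(`) g ` theta_edges (1 # ps) \<subseteq> span_edges x y Qs"
    proof
      fix e assume "e \<in> (`) g ` theta_edges (1 # ps)"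
      then obtain i j where ij: "i < length (1 # ps)" "j < (1 # ps) ! i"
        "e = {g (theta_vertex (1 # ps) i j), g (theta_vertex (1 # ps) i (j + 1))}"
        unfolding theta_edges_def by auto
      show "e \<in> span_edges x y Qs"
      proof (cases i)
        case 0
        then show ?thesis using ij unfolding span_edges_def by (simp add: theta_vertex_def g0)
      next
        case (Suc k)
        then have k: "k < length Qs" "j \<le> length (Qs ! k)" using ij unfolding ps_def by auto
        then have "e = {(x # Qs ! k @ [y]) ! j, (x # Qs ! k @ [y]) ! Suc j}"
          using ij Suc gtv[of k j] gtv[of k "Suc j"] by simp
        then have "e \<in> path_edges (x # Qs ! k @ [y])"
          using k unfolding path_edges_conv_nth by (intro CollectI exI[of _ j]) simp
        then show ?thesis using k unfolding span_edges_def by auto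
      qed
    qed
    show "span_edges x y Qs \<subseteq> (`) g ` theta_edges (1 # ps)"
    proof
      fix e assume "e \<in> span_edges x y Qs"
      then consider "e = {x, y}" | q where "q \<in> set Qs" "e \<in> path_edges (x # q @ [y])"
        unfolding span_edges_def by auto
      then obtain i j where ij: "i < length (1 # ps)" "j < (1 # ps) ! i"
        "e = {g (theta_vertex (1 # ps) i j), g (theta_vertex (1 # ps) i (j + 1))}"
      proof cases
        case 1
        then show ?thesis using that[of 0 0] by (simp add: theta_vertex_def g0)
      next
        case (2 q)
        then obtain k where k: "k < length Qs" "Qs ! k = q" by (meson in_set_conv_nth)
        obtain j where j: "Suc j < length (x # q @ [y])" "e = {(x # q @ [y]) ! j, (x # q @ [y]) ! Suc j}"
          using 2 unfolding path_edges_conv_nth by blast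
        show ?thesis
          using that[of "Suc k" j] k j gtv[of k j] gtv[of k "Suc j"] unfolding ps_def by simp
      qed
      then have "{theta_vertex (1 # ps) i j, theta_vertex (1 # ps) i (j + 1)} \<in> theta_edges (1 # ps)"
        unfolding theta_edges_def by blast
      then show "e \<in> (`) g ` theta_edges (1 # ps)" using ij(3)
        by (intro image_eqI[of _ _ "{theta_vertex (1 # ps) i j, theta_vertex (1 # ps) i (j + 1)}"]) auto
    qed
  qed
  show ?thesis
  proof (rule graph_iso_of_image)
    show "bij_betw g (theta_verts (1 # ps)) (span_verts x y Qs)" using inj img unfolding bij_betw_def by simp
    show "e \<subseteq> theta_verts (1 # ps)" if e: "e \<in> theta_edges (1 # ps)" for e
    proof -
      obtain i j where "i < length (1 # ps)" "j < (1 # ps) ! i"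
        "e = {theta_vertex (1 # ps) i j, theta_vertex (1 # ps) i (j + 1)}"
        using e unfolding theta_edges_def by blast
      then show ?thesis using tv[of i j] tv[of i "j + 1"] by simp
    qed
  qed (rule edges)
qed

section \<open>Structure of the non-bipartite blocks\<close>

lemma length_le_length_concat: "\<forall>q\<in>set Qs. q \<noteq> [] \<Longrightarrow> length Qs \<le> length (concat Qs)"
proof (induction Qs)
  case (Cons q Qs)
  then show ?case by (cases q) auto
qed simp

lemma even_theta_span:
  assumes "simple_graph V E" "even_theta E x y Qs"
  shows "span_verts x y Qs \<subseteq> V" "span_edges x y Qs \<subseteq> E"
proof -
  have xy: "{x, y} \<in> E" and Q: "\<forall>q\<in>set Qs. link E x q y" using assms(2) unfolding even_theta_def by auto
  have "set q \<subseteq> V" if "q \<in> set Qs" for q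
    using linked_subset[OF assms(1)] Q that by fastforce
  moreover have "{x, y} \<subseteq> V" using simple_graph_Union[OF assms(1)] xy by blast
  ultimately show "span_verts x y Qs \<subseteq> V" unfolding span_verts_def by auto
  show "span_edges x y Qs \<subseteq> E" using xy Q unfolding span_edges_def link_def by auto
qed

text \<open>Every path brings an inner vertex of its own. The bound ensures that the maximum number
  of paths exists.\<close>

lemma even_theta_length_le:
  assumes "simple_graph V E" "even_theta E x y Qs"
  shows "length Qs \<le> card V"
proof -
  have "\<forall>q\<in>set Qs. q \<noteq> []" using assms(2) unfolding even_theta_def by auto
  then have "length Qs \<le> length (concat Qs)" by (rule length_le_length_concat)
  also have "\<dots> = card (set (concat Qs))"
    using assms(2) unfolding even_theta_def by (metis distinct.simps(2) distinct_card)
  also have "\<dots> \<le> card V"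
    using even_theta_span(1)[OF assms] assms(1) unfolding span_verts_def simple_graph_def
    by (intro card_mono) auto
  finally show ?thesis .
qed

text \<open>The closing edge of the cycle is the base edge, and the rest is a path of even
  length.\<close>

lemma odd_cycle_imp_even_theta:
  assumes "is_cycle V E ys" "odd (length ys)"
  shows "\<exists>x y q. even_theta E x y [q]"
proof -
  have ys: "ys \<noteq> []" "3 \<le> length ys" "distinct ys" "cycle_edges ys \<subseteq> E"
    using assms unfolding is_cycle_def by auto
  have "hd ys \<noteq> last ys"
    using ys nth_eq_iff_index_eq[OF ys(3), of 0 "length ys - 1"] by (simp add: hd_conv_nth last_conv_nth)
  then obtain q where q: "ys = hd ys # q @ [last ys]" using list_hd_lastE ys(1) by metis
  have "{hd ys, last ys} \<in> E" "path_edges ys \<subseteq> E"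
    using ys(4) cycle_edges_conv[OF ys(1)] by (auto simp: insert_commute)
  moreover have "odd (length q)" using assms(2) arg_cong[OF q, of length] by simp
  moreover have "link E (hd ys) q (last ys)"
    using ys(3) \<open>path_edges ys \<subseteq> E\<close> q unfolding link_def by simp
  ultimately have "even_theta E (hd ys) (last ys) [q]"
    unfolding even_theta_def by (auto simp: link_def)
  then show ?thesis by blast
qed

lemma G_star_two_connected_structure:
  assumes sg: "simple_graph V E" and tc: "two_connected V E" and gs: "G_star V E"
    and nb: "\<not> bipartite V E"
  shows "graph_iso V E K4_verts K4_edges \<or>
    (\<exists>ps. length ps \<ge> 1 \<and> (\<forall>p \<in> set ps. even p \<and> p > 0) \<and>
       graph_iso V E (theta_verts (1 # ps)) (theta_edges (1 # ps)))"
proof -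
  have "connected V E" using tc unfolding two_connected_def by blast
  then obtain x0 y0 q0 where th0: "even_theta E x0 y0 [q0]"
    using nonbipartite_imp_odd_cycle[OF sg _ nb] odd_cycle_imp_even_theta by metis
  \<comment> \<open>The maximum is taken over all base edges, since an ear may give a larger theta
    graph on a different one.\<close>
  let ?P = "\<lambda>(x, y, Qs). even_theta E x y Qs" and ?len = "\<lambda>(x, y, Qs). length Qs"
  have "\<exists>z. ?P z \<and> (\<forall>z'. ?P z' \<longrightarrow> ?len z' \<le> ?len z)"
    by (rule ex_has_greatest_nat[of ?P "(x0, y0, [q0])" ?len "Suc (card V)"])
      (use th0 even_theta_length_le[OF sg] in \<open>auto simp: less_Suc_eq_le\<close>)
  then obtain x y Qs where th: "even_theta E x y Qs"
    and max: "\<And>x y Rs. even_theta E x y Rs \<Longrightarrow> length Rs \<le> length Qs" by auto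
  have ne: "Qs \<noteq> []" using max[OF th0] by auto
  have xy: "x \<noteq> y" "{x, y} \<in> E" and dist: "distinct (concat Qs)"
    and Q: "\<And>q. q \<in> set Qs \<Longrightarrow> odd (length q) \<and> link E x q y"
    using th unfolding even_theta_def by auto
  let ?U = "span_verts x y Qs" and ?F = "span_edges x y Qs"
  show ?thesis
  proof (cases "?U \<noteq> V \<or> ?F \<noteq> E")
    case False
    let ?ps = "map (\<lambda>q. length q + 1) Qs"
    have "graph_iso V E (theta_verts (1 # ?ps)) (theta_edges (1 # ?ps))"
      using even_theta_imp_graph_iso[OF th] False by simp
    moreover have "length ?ps \<ge> 1" using ne by (simp add: Suc_le_eq)
    moreover have "\<forall>p\<in>set ?ps. even p \<and> p > 0" using Q by auto
    ultimately show ?thesis by blast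
  next
    case True
    have "x \<in> ?U" "y \<in> ?U" unfolding span_verts_def by auto
    then obtain c p d where p: "c \<in> ?U" "d \<in> ?U" "link E c p d" "set p \<inter> ?U = {}"
      "p = [] \<Longrightarrow> {c, d} \<notin> ?F"
      using ear_exists[OF sg tc even_theta_span[OF sg th] _ _ xy(1) True] by metis
    have cd: "c \<noteq> d" using p(3) unfolding link_def by auto
    have no: "\<not> {c, d} \<subseteq> set (x # q @ [y])" if q: "q \<in> set Qs" for q
    proof
      assume "{c, d} \<subseteq> set (x # q @ [y])"
      then obtain s t where st: "x # q @ [y] = s @ c # t" "d \<in> set s \<or> d \<in> set t"
        using split_list[of c "x # q @ [y]"] cd
        by (metis Un_iff insert_iff insert_subset list.simps(15) set_append)
      from st(2) show False
      proof
        assume "d \<in> set t"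
        then obtain m t' where "t = m @ d # t'" using split_list by metis
        with st(1) have L: "x # q @ [y] = s @ c # m @ d # t'" by simp
        show False
          by (rule even_theta_ear_same_path[OF sg gs th _ q L p(3,4)]) (erule max, erule p(5))
      next
        assume "d \<in> set s"
        then obtain s' m where "s = s' @ d # m" using split_list by metis
        with st(1) have L: "x # q @ [y] = s' @ d # m @ c # t" by simp
        show False
          by (rule even_theta_ear_same_path[OF sg gs th _ q L link_sym[OF p(3)]])
            (erule max, use p(4,5) in \<open>auto simp: insert_commute\<close>)
      qed
    qed
    obtain q where q: "q \<in> set Qs" using ne by (cases Qs) auto
    \<comment> \<open>Every vertex of the theta graph shares a path with \<open>x\<close> and with
      \<open>y\<close>, so an end of the ear at \<open>x\<close> or \<open>y\<close> would put both
      ends on one path.\<close>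
    have "c \<notin> {x, y}" "d \<notin> {x, y}" using no p(1,2) q unfolding span_verts_def by auto
    then obtain q1 q2 where q12: "q1 \<in> set Qs" "c \<in> set q1" "q2 \<in> set Qs" "d \<in> set q2"
      using p(1,2) unfolding span_verts_def by auto
    then have "q1 \<noteq> q2" using no[of q1] by auto
    then have disj: "set q1 \<inter> set q2 = {}" using dist q12 by (simp add: distinct_concat_iff)
    obtain a1 a2 where a: "q1 = a1 @ c # a2" using q12 split_list by metis
    obtain b1 b2 where b: "q2 = b1 @ d # b2" using q12 split_list by metis
    have l: "link E x (a1 @ c # a2) y" "link E x (b1 @ d # b2) y"
      "even (length a1 + length a2)" "even (length b1 + length b2)"
      using Q[OF q12(1)] Q[OF q12(3)] a b by auto
    have disj': "set (a1 @ c # a2) \<inter> set (b1 @ d # b2) = {}" using disj a b by simp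
    have "set q1 \<union> set q2 \<union> {x, y} \<subseteq> ?U" using q12 unfolding span_verts_def by auto
    then have pd: "set p \<inter> ({x, y} \<union> set (a1 @ c # a2) \<union> set (b1 @ d # b2)) = {}"
      using p(4) a b by blast
    have r1: "a1 = [] \<and> even (length p + length b1)"
      by (rule G_star_cross_ear[OF sg gs xy l(1-3) disj' p(3) pd])
    \<comment> \<open>The same argument after exchanging the two paths; reversing both paths then
      exchanges \<open>x\<close> and \<open>y\<close> and settles \<open>a2\<close> and
      \<open>b2\<close>.\<close>
    have "b1 = []"
      using G_star_cross_ear[OF sg gs xy l(2,1,4) _ link_sym[OF p(3)]] disj' pd by auto
    have yx: "y \<noteq> x" "{y, x} \<in> E" using xy by (auto simp: insert_commute)
    have lr: "link E y (rev a2 @ c # rev a1) x" "link E y (rev b2 @ d # rev b1) x"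
      using link_sym[OF l(1)] link_sym[OF l(2)] by simp_all
    have "rev a2 = []"
      using G_star_cross_ear[OF sg gs yx lr _ _ p(3)] l(3) disj' pd by auto
    have "rev b2 = []"
      using G_star_cross_ear[OF sg gs yx lr(2,1) _ _ link_sym[OF p(3)]] l(4) disj' pd by auto
    have emp: "a1 = []" "a2 = []" "b1 = []" "b2 = []" "even (length p)"
      using r1 \<open>b1 = []\<close> \<open>rev a2 = []\<close> \<open>rev b2 = []\<close> by auto
    have e: "{x, c} \<in> E" "{c, y} \<in> E" "{x, d} \<in> E" "{d, y} \<in> E" "c \<noteq> x" "c \<noteq> y" "d \<noteq> x" "d \<noteq> y"
      using l(1,2) emp by (auto simp: link_Cons_iff)
    \<comment> \<open>Between \<open>c\<close> and \<open>d\<close> the paths through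
      \<open>x\<close> and \<open>y\<close> have length 2 while \<open>p\<close> has odd length, so
      \<open>p\<close> is a single edge and completes a \<open>K\<^sub>4\<close>.\<close>
    have lx: "link E c [x] d" "link E c [y] d"
      using e cd by (auto simp: link_Cons_iff insert_commute)
    have "p = []"
      by (rule G_star_three_links[OF sg gs lx(1) p(3) lx(2)]) (use pd xy emp in auto)
    then have cdE: "{c, d} \<in> E" using p(3) by simp
    let ?K = "{x, y, c, d}"
    have K: "all_edges ?K \<subseteq> E"
      using e xy cdE unfolding all_edges_def by (auto simp: insert_commute)
    have "card ?K = 4" using e xy cd by auto
    moreover have "?K \<subseteq> V"
      using even_theta_span(1)[OF sg th] p(1,2) \<open>x \<in> ?U\<close> \<open>y \<in> ?U\<close> by blast
    ultimately show ?thesis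
      using G_star_K4_spanning[OF sg gs tc _ _ K] card_4_graph_iso_K4[of ?K] by simp
  qed
qed

section \<open>Odd cycles in bipartite graphs, theta graphs and \<open>K\<^sub>4\<close>\<close>

lemma alternating_path:
  "(\<And>u v. {u, v} \<in> path_edges (x # xs) \<Longrightarrow> f u \<noteq> f v) \<Longrightarrow> f (last (x # xs)) = (f x = even (length xs))"
proof (induction xs arbitrary: x)
  case (Cons y xs)
  have "f (last (y # xs)) = (f y = even (length xs))" using Cons by simp
  moreover have "f x \<noteq> f y" using Cons.prems[of x y] by simp
  ultimately show ?case by auto
qed simp

lemma alternating_cycle_even:
  fixes f :: "'a \<Rightarrow> bool"
  assumes "xs \<noteq> []" "\<And>u v. {u, v} \<in> cycle_edges xs \<Longrightarrow> f u \<noteq> f v"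
  shows "even (length xs)"
proof -
  obtain x ys where xs: "xs = x # ys" using assms(1) by (cases xs) auto
  have "f (last (x # ys)) = (f x = even (length ys))"
    by (rule alternating_path) (use assms(2) cycle_edges_conv[OF assms(1)] xs in auto)
  moreover have "f (last (x # ys)) \<noteq> f x"
    by (rule assms(2)) (use cycle_edges_conv[OF assms(1)] xs in auto)
  ultimately show ?thesis using xs by auto
qed

lemma bipartite_G_star:
  assumes "bipartite V E"
  shows "G_star V E"
proof -
  obtain A where A: "\<And>e. e \<in> E \<Longrightarrow> \<exists>u v. e = {u, v} \<and> u \<in> A \<and> v \<in> V - A"
    using assms unfolding bipartite_def by blast
  have "even (length xs)" if "is_cycle V E xs" for xs
  proof (rule alternating_cycle_even[where f = "\<lambda>v. v \<in> A"])
    show "xs \<noteq> []" using that unfolding is_cycle_def by auto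
    fix u v assume "{u, v} \<in> cycle_edges xs"
    then have "{u, v} \<in> E" using that unfolding is_cycle_def by blast
    then obtain u' v' where "{u, v} = {u', v'}" "u' \<in> A" "v' \<in> V - A" using A by metis
    then show "(u \<in> A) \<noteq> (v \<in> A)" by (auto simp: doubleton_eq_iff)
  qed
  then have "odd_cycles V E = {}" unfolding odd_cycles_def by blast
  then show ?thesis unfolding G_star_def by simp
qed

text \<open>Rotation: any vertex of a cycle can be moved to the front.\<close>

lemma cycle_edges_append_commute: "cycle_edges (xs @ ys) = cycle_edges (ys @ xs)"
proof (cases "xs = [] \<or> ys = []")
  case False
  then show ?thesis
    by (simp add: cycle_edges_conv path_edges_append_nonempty) auto
qed auto

lemma cycle_edges_at_vertex:
  assumes "distinct xs" "3 \<le> length xs" "v \<in> set xs"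
  obtains e1 e2 where "e1 \<noteq> e2" "{e \<in> cycle_edges xs. v \<in> e} = {e1, e2}"
proof -
  obtain s t where xs: "xs = s @ v # t" using assms(3) split_list by metis
  let ?r = "t @ s"
  have r: "?r \<noteq> []" "v \<notin> set ?r" "distinct ?r" "2 \<le> length ?r" using xs assms by auto
  have "cycle_edges xs = cycle_edges ([v] @ ?r)"
    using cycle_edges_append_commute[of s "v # t"] xs by simp
  also have "\<dots> = {{last ?r, v}, {v, hd ?r}} \<union> path_edges ?r"
    using r(1) by (subst cycle_edges_conv) (auto simp: path_edges_append_nonempty[of "[v]" ?r, simplified])
  finally have c: "cycle_edges xs = {{last ?r, v}, {v, hd ?r}} \<union> path_edges ?r" .
  have "v \<notin> e" if "e \<in> path_edges ?r" for e using path_edges_subset[OF that] r(2) by blast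
  then have at: "{e \<in> cycle_edges xs. v \<in> e} = {{last ?r, v}, {v, hd ?r}}" unfolding c by auto
  have "last ?r \<noteq> hd ?r"
    using r nth_eq_iff_index_eq[OF r(3), of "length ?r - 1" 0] by (simp add: hd_conv_nth last_conv_nth)
  then have "{last ?r, v} \<noteq> {v, hd ?r}" by (auto simp: doubleton_eq_iff)
  then show ?thesis using at by (rule that)
qed

text \<open>The coordinates of an inner vertex determine its path and its position there, which
  leaves the edge before it and the edge after it.\<close>

lemma theta_edges_at_inner_vertex:
  assumes "e \<in> theta_edges qs" "(Suc i, Suc j) \<in> e" "Suc j < qs ! i"
  shows "e = {theta_vertex qs i j, theta_vertex qs i (Suc j)} \<or>
    e = {theta_vertex qs i (Suc j), theta_vertex qs i (Suc (Suc j))}"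
proof -
  obtain i' j' where e: "e = {theta_vertex qs i' j', theta_vertex qs i' (Suc j')}"
    using assms(1) unfolding theta_edges_def by auto
  then consider "theta_vertex qs i' j' = (Suc i, Suc j)" | "theta_vertex qs i' (Suc j') = (Suc i, Suc j)"
    using assms(2) by auto
  then show ?thesis
  proof cases
    case 1
    then have "i' = i" "j' = Suc j" by (auto simp: theta_vertex_def split: if_splits)
    then show ?thesis using e by simp
  next
    case 2
    then have "i' = i" "j' = j" by (auto simp: theta_vertex_def split: if_splits)
    then show ?thesis using e by simp
  qed
qed

text \<open>The right-hand side depends on \<open>i\<close> alone, so two odd cycles with a common
  edge besides the base edge coincide.\<close>

lemma odd_cycle_in_even_theta:
  assumes ps: "\<forall>p\<in>set ps. even p \<and> p > 0"
    and cyc: "is_cycle (theta_verts (1 # ps)) (theta_edges (1 # ps)) xs" "odd (length xs)"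
    and ij: "i < length ps" "j < ps ! i"
      "{theta_vertex (1 # ps) (Suc i) j, theta_vertex (1 # ps) (Suc i) (Suc j)} \<in> cycle_edges xs"
  shows "cycle_edges xs = insert {(0, 0), (0, 1)}
    {{theta_vertex (1 # ps) (Suc i) k, theta_vertex (1 # ps) (Suc i) (Suc k)} | k. k < ps ! i}"
proof -
  let ?qs = "1 # ps" and ?C = "cycle_edges xs"
  define e where "e i j = {theta_vertex ?qs i j, theta_vertex ?qs i (Suc j)}" for i j
  let ?base = "{(0, 0), (0, 1)} :: (nat \<times> nat) set"
  have e0: "e 0 0 = ?base" by (auto simp: e_def theta_vertex_def)
  have xs: "xs \<noteq> []" "distinct xs" "3 \<le> length xs" and CE: "?C \<subseteq> theta_edges ?qs"
    using cyc unfolding is_cycle_def by auto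
  have psge: "even (ps ! k)" "2 \<le> ps ! k" if "k < length ps" for k
    using ps nth_mem[OF that] by (auto elim!: evenE simp: Suc_le_eq)
  have edgeE: "\<exists>i j. f = e i j \<and> i < length ?qs \<and> j < ?qs ! i" if "f \<in> ?C" for f
    using CE that unfolding theta_edges_def e_def by auto
  have base: "?base \<in> ?C"
  proof (rule ccontr)
    assume nb: "?base \<notin> ?C"
    \<comment> \<open>Without the base edge the graph is 2-coloured by the parity of positions. The
      end \<open>(0, 1)\<close> is set apart: it closes paths of even length, although its second
      coordinate is odd.\<close>
    define f where "f = (\<lambda>v :: nat \<times> nat. v = (0, 1) \<or> even (snd v))"
    have ft: "f (theta_vertex ?qs (Suc k) l) = even l" if "k < length ps" "l \<le> ps ! k" for k l
      using that psge[of k] by (auto simp: f_def theta_vertex_def)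
    have "even (length xs)"
    proof (rule alternating_cycle_even[OF xs(1), where f = f])
      fix u v assume uv: "{u, v} \<in> ?C"
      then obtain i j where ij: "{u, v} = e i j" "i < length ?qs" "j < ?qs ! i" using edgeE by blast
      have "i \<noteq> 0" using ij e0 nb uv by (cases "i = 0") auto
      then obtain k where "i = Suc k" by (cases i) auto
      then have "f (theta_vertex ?qs i j) \<noteq> f (theta_vertex ?qs i (Suc j))"
        using ft[of k j] ft[of k "Suc j"] ij by simp
      then show "f u \<noteq> f v" using ij(1) unfolding e_def by (auto simp: doubleton_eq_iff)
    qed
    with cyc(2) show False by simp
  qed
  \<comment> \<open>The cycle has two edges at each of its vertices and an inner vertex offers only
    two, so the cycle uses both or neither.\<close>
  have step: "e (Suc k) l \<in> ?C \<longleftrightarrow> e (Suc k) (Suc l) \<in> ?C" if kl: "k < length ps" "Suc l < ps ! k" for k l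
  proof -
    let ?v = "(Suc (Suc k), Suc l)"
    have v: "?v \<in> e (Suc k) l" "?v \<in> e (Suc k) (Suc l)"
      using kl by (auto simp: e_def theta_vertex_def)
    have "e (Suc k) l \<in> ?C \<and> e (Suc k) (Suc l) \<in> ?C" if vC: "?v \<in> \<Union> ?C"
    proof -
      have "?v \<in> set xs" using vC Union_cycle_edges[OF xs(1)] by simp
      then obtain e1 e2 where e12: "e1 \<noteq> e2" "{f \<in> ?C. ?v \<in> f} = {e1, e2}"
        using cycle_edges_at_vertex[OF xs(2,3)] by metis
      then have m: "e1 \<in> ?C" "e2 \<in> ?C" "?v \<in> e1" "?v \<in> e2" by auto
      have "f = e (Suc k) l \<or> f = e (Suc k) (Suc l)" if "f \<in> ?C" "?v \<in> f" for f
        using theta_edges_at_inner_vertex[of f ?qs "Suc k" l] that CE kl unfolding e_def by auto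
      then show ?thesis using m e12(1) by metis
    qed
    then show ?thesis using v by blast
  qed
  have all: "e (Suc k) l \<in> ?C \<longleftrightarrow> e (Suc k) 0 \<in> ?C" if "k < length ps" "l < ps ! k" for k l
    using that(2)
  proof (induction l)
    case (Suc l)
    then show ?case using step[OF that(1), of l] by simp
  qed simp
  \<comment> \<open>One of the two cycle edges at \<open>(0, 0)\<close> is the base edge, so at most
    one path can be entered there.\<close>
  have uniq: "k = k'" if k: "k < length ps" "e (Suc k) 0 \<in> ?C" and k': "k' < length ps" "e (Suc k') 0 \<in> ?C"
    for k k'
  proof -
    have ex: "e (Suc k) 0 = {(0, 0), (Suc (Suc k), 1)}" if "k < length ps" for k
      using psge[OF that] by (auto simp: e_def theta_vertex_def)
    have "(0, 0) \<in> \<Union> ?C" using base by blast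
    then have "(0, 0) \<in> set xs" using Union_cycle_edges[OF xs(1)] by simp
    then obtain e1 e2 where e12: "e1 \<noteq> e2" "{f \<in> ?C. (0, 0) \<in> f} = {e1, e2}"
      using cycle_edges_at_vertex[OF xs(2,3)] by metis
    have "?base \<in> {e1, e2}" "e (Suc k) 0 \<in> {e1, e2}" "e (Suc k') 0 \<in> {e1, e2}"
      using e12(2)[symmetric] base k k' ex by auto
    moreover have "e (Suc k) 0 \<noteq> ?base" "e (Suc k') 0 \<noteq> ?base"
      using ex k(1) k'(1) by (auto simp: doubleton_eq_iff)
    ultimately have "e (Suc k) 0 = e (Suc k') 0" by (metis insertE singletonD)
    then show ?thesis using ex[OF k(1)] ex[OF k'(1)] by (simp add: doubleton_eq_iff)
  qed
  have i0: "e (Suc i) 0 \<in> ?C" using all[OF ij(1,2)] ij(3) unfolding e_def by simp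
  have "?C = insert ?base {e (Suc i) k | k. k < ps ! i}"
  proof
    show "?C \<subseteq> insert ?base {e (Suc i) k | k. k < ps ! i}"
    proof
      fix f assume f: "f \<in> ?C"
      then obtain i' j' where ij': "f = e i' j'" "i' < length ?qs" "j' < ?qs ! i'" using edgeE by blast
      show "f \<in> insert ?base {e (Suc i) k | k. k < ps ! i}"
      proof (cases i')
        case 0
        then show ?thesis using ij' e0 by simp
      next
        case (Suc k)
        then have "e (Suc k) 0 \<in> ?C" using all[of k j'] ij' f by simp
        then have "k = i" using uniq i0 ij(1) ij' Suc by simp
        then show ?thesis using ij' Suc by auto
      qed
    qed
    show "insert ?base {e (Suc i) k | k. k < ps ! i} \<subseteq> ?C"
      using base all[OF ij(1)] i0 by auto
  qed
  then show ?thesis unfolding e_def .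
qed

lemma even_theta_G_star:
  assumes ps: "\<forall>p\<in>set ps. even p \<and> p > 0"
  shows "G_star (theta_verts (1 # ps)) (theta_edges (1 # ps))"
  unfolding G_star_def
proof (intro ballI impI)
  fix C D assume C: "C \<in> odd_cycles (theta_verts (1 # ps)) (theta_edges (1 # ps))"
    and D: "D \<in> odd_cycles (theta_verts (1 # ps)) (theta_edges (1 # ps))" and ne: "C \<noteq> D"
  obtain xs where xs: "C = cycle_edges xs" "is_cycle (theta_verts (1 # ps)) (theta_edges (1 # ps)) xs"
    "odd (length xs)" using C unfolding odd_cycles_def by blast
  obtain ys where ys: "D = cycle_edges ys" "is_cycle (theta_verts (1 # ps)) (theta_edges (1 # ps)) ys"
    "odd (length ys)" using D unfolding odd_cycles_def by blast
  have "C \<inter> D \<subseteq> {{(0, 0), (0, 1)}}"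
  proof
    fix f assume f: "f \<in> C \<inter> D"
    then have "f \<in> theta_edges (1 # ps)" using xs unfolding is_cycle_def by blast
    then obtain i j where ij: "f = {theta_vertex (1 # ps) i j, theta_vertex (1 # ps) i (Suc j)}"
      "i < length (1 # ps)" "j < (1 # ps) ! i" unfolding theta_edges_def by auto
    show "f \<in> {{(0, 0), (0, 1)}}"
    proof (cases i)
      case 0
      then show ?thesis using ij by (simp add: theta_vertex_def)
    next
      case (Suc k)
      then have "k < length ps" "j < ps ! k" using ij by auto
      then have "cycle_edges xs = cycle_edges ys"
        using odd_cycle_in_even_theta[OF ps xs(2,3), of k j] odd_cycle_in_even_theta[OF ps ys(2,3), of k j]
          f ij(1) Suc xs(1) ys(1) by simp
      then have "C = D" using xs ys by simp
      with ne show ?thesis by simp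
    qed
  qed
  then show "card (C \<inter> D) \<le> 1" using card_mono[of "{{(0, 0), (0, 1)}}" "C \<inter> D"] by simp
qed

text \<open>Odd cycles on four vertices are triangles, and the union of any two edges of a triangle
  is its vertex set, which determines it.\<close>

lemma K4_G_star: "G_star K4_verts K4_edges"
  unfolding G_star_def
proof (intro ballI impI)
  have tri: "\<exists>S. C = all_edges S \<and> (\<forall>e\<in>C. \<forall>f\<in>C. e \<noteq> f \<longrightarrow> e \<union> f = S)"
    if C: "C \<in> odd_cycles K4_verts K4_edges" for C
  proof -
    obtain xs where xs: "C = cycle_edges xs" "is_cycle K4_verts K4_edges xs" "odd (length xs)"
      using C unfolding odd_cycles_def by blast
    then have "length xs = card (set xs)" "set xs \<subseteq> K4_verts" "3 \<le> length xs"
      unfolding is_cycle_def by (auto simp: distinct_card)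
    moreover from this have "card (set xs) \<le> 4"
      using card_mono[of K4_verts "set xs"] unfolding K4_verts_def by simp
    ultimately have "length xs = 3" using xs(3) by presburger
    then obtain a b c where abc: "xs = [a, b, c]" by (auto simp: numeral_3_eq_3 length_Suc_conv)
    then have d: "a \<noteq> b" "b \<noteq> c" "a \<noteq> c" using xs(2) unfolding is_cycle_def by auto
    have C: "C = {{a, b}, {b, c}, {c, a}}" using xs(1) abc by (auto simp: cycle_edges_conv)
    also have "\<dots> = all_edges {a, b, c}"
      using d unfolding all_edges_def by (auto simp: insert_commute)
    finally have "C = all_edges {a, b, c}" .
    moreover have "\<forall>e\<in>C. \<forall>f\<in>C. e \<noteq> f \<longrightarrow> e \<union> f = {a, b, c}" unfolding C by auto
    ultimately show ?thesis by blast
  qed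
  fix C D assume C: "C \<in> odd_cycles K4_verts K4_edges" and D: "D \<in> odd_cycles K4_verts K4_edges"
    and ne: "C \<noteq> D"
  obtain S where S: "C = all_edges S" "\<forall>e\<in>C. \<forall>f\<in>C. e \<noteq> f \<longrightarrow> e \<union> f = S" using tri[OF C] by blast
  obtain T where T: "D = all_edges T" "\<forall>e\<in>D. \<forall>f\<in>D. e \<noteq> f \<longrightarrow> e \<union> f = T" using tri[OF D] by blast
  have "finite (C \<inter> D)" using C unfolding odd_cycles_def by auto
  then show "card (C \<inter> D) \<le> 1"
    using S T ne by (metis IntD1 IntD2 card_le_Suc0_iff_eq One_nat_def)
qed

section \<open>Transport of the class along isomorphisms\<close>

lemma path_edges_map: "path_edges (map f xs) = (`) f ` path_edges xs"
  by (induction xs rule: path_edges.induct) simp_all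

lemma cycle_edges_map: "cycle_edges (map f xs) = (`) f ` cycle_edges xs"
proof (cases "xs = []")
  case False
  then show ?thesis by (simp add: cycle_edges_conv path_edges_map last_map hd_map)
qed (simp add: cycle_edges_def)

text \<open>The map induced on edges is injective on subsets of \<open>V\<close>, so distinct odd
  cycles stay distinct and intersections keep their size.\<close>

lemma G_star_graph_iso:
  assumes iso: "graph_iso V E W F" and gs: "G_star W F" and sg: "simple_graph V E"
  shows "G_star V E"
proof -
  obtain f where f: "bij_betw f V W" "\<And>u v. u \<in> V \<Longrightarrow> v \<in> V \<Longrightarrow> {u, v} \<in> E \<longleftrightarrow> {f u, f v} \<in> F"
    using iso unfolding graph_iso_def by blast
  have inj: "inj_on f V" "f ` V = W" using f(1) unfolding bij_betw_def by auto
  have injP: "inj_on ((`) f) (Pow V)" using inj(1) by (rule inj_on_image_Pow)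
  have EF: "f ` e \<in> F" if e: "e \<in> E" for e
  proof -
    obtain u v where "u \<in> V" "v \<in> V" "e = {u, v}" using simple_graphE[OF sg e] by metis
    then show ?thesis using f(2) e by simp
  qed
  have odd: "(`) f ` C \<in> odd_cycles W F \<and> C \<subseteq> Pow V" if C: "C \<in> odd_cycles V E" for C
  proof -
    obtain xs where xs: "C = cycle_edges xs" "is_cycle V E xs" "odd (length xs)"
      using C unfolding odd_cycles_def by blast
    have "distinct (map f xs)"
      using xs(2) inj(1) unfolding is_cycle_def by (auto simp: distinct_map intro: inj_on_subset)
    then have "is_cycle W F (map f xs)"
      using xs(2) inj(2) EF unfolding is_cycle_def cycle_edges_map by auto
    then have "(`) f ` C \<in> odd_cycles W F"
      using xs unfolding odd_cycles_def by (metis (mono_tags, lifting) CollectI cycle_edges_map length_map)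
    moreover have "C \<subseteq> Pow V"
      using xs simple_graph_Union[OF sg] unfolding is_cycle_def by blast
    ultimately show ?thesis by simp
  qed
  show ?thesis unfolding G_star_def
  proof (intro ballI impI)
    fix C D assume C: "C \<in> odd_cycles V E" and D: "D \<in> odd_cycles V E" and ne: "C \<noteq> D"
    have "(`) f ` C \<noteq> (`) f ` D" using inj_on_image_eq_iff[OF injP] odd[OF C] odd[OF D] ne by simp
    then have "card ((`) f ` C \<inter> (`) f ` D) \<le> 1" using gs odd[OF C] odd[OF D] unfolding G_star_def by simp
    moreover have "(`) f ` C \<inter> (`) f ` D = (`) f ` (C \<inter> D)"
      using inj_on_image_Int[OF injP] odd[OF C] odd[OF D] by simp
    moreover have "card ((`) f ` (C \<inter> D)) = card (C \<inter> D)"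
      using odd[OF C] by (intro card_image inj_on_subset[OF injP]) blast
    ultimately show "card (C \<inter> D) \<le> 1" by simp
  qed
qed

section \<open>Blocks\<close>

lemma connected_mono:
  assumes "connected V E" "E \<subseteq> E'"
  shows "connected V E'"
proof -
  have "{(x, y). {x, y} \<in> E \<and> x \<in> V \<and> y \<in> V}\<^sup>* \<subseteq> {(x, y). {x, y} \<in> E' \<and> x \<in> V \<and> y \<in> V}\<^sup>*"
    using assms(2) by (intro rtrancl_mono) auto
  then show ?thesis using assms(1) unfolding connected_def by blast
qed

lemma connected_Un:
  assumes c: "connected V E" "connected V' E'" and ne: "V \<inter> V' \<noteq> {}"
  shows "connected (V \<union> V') (E \<union> E')"
proof -
  let ?R = "{(x, y). {x, y} \<in> E \<union> E' \<and> x \<in> V \<union> V' \<and> y \<in> V \<union> V'}\<^sup>*"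
  obtain z where z: "z \<in> V" "z \<in> V'" using ne by blast
  have "{(x, y). {x, y} \<in> E \<and> x \<in> V \<and> y \<in> V}\<^sup>* \<subseteq> ?R"
    "{(x, y). {x, y} \<in> E' \<and> x \<in> V' \<and> y \<in> V'}\<^sup>* \<subseteq> ?R" by (intro rtrancl_mono; auto)+
  then have uz: "(u, z) \<in> ?R" "(z, u) \<in> ?R" if "u \<in> V \<union> V'" for u
    using that c z unfolding connected_def by blast+
  have "(u, v) \<in> ?R" if "u \<in> V \<union> V'" "v \<in> V \<union> V'" for u v
    using uz(1)[OF that(1)] uz(2)[OF that(2)] by (rule rtrancl_trans)
  then show ?thesis using z unfolding connected_def by blast
qed

lemma connected_path: "xs \<noteq> [] \<Longrightarrow> connected (set xs) (path_edges xs)"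
proof (induction xs rule: path_edges.induct)
  case (1 x y xs)
  have "connected {x, y} {{x, y}}"
    unfolding connected_def by (auto simp: insert_commute intro!: r_into_rtrancl)
  then have "connected ({x, y} \<union> set (y # xs)) ({{x, y}} \<union> path_edges (y # xs))"
    using 1 by (intro connected_Un) auto
  then show ?case by (simp add: insert_absorb)
qed (auto simp: connected_def)

lemma two_connected_cycle:
  assumes "distinct xs" "3 \<le> length xs"
  shows "two_connected (set xs) (cycle_edges xs)"
  unfolding two_connected_def
proof (intro conjI ballI)
  have ne: "xs \<noteq> []" using assms by auto
  show "3 \<le> card (set xs)" using assms by (simp add: distinct_card)
  show "connected (set xs) (cycle_edges xs)"
    by (rule connected_mono[OF connected_path[OF ne]]) (use cycle_edges_conv[OF ne] in auto)
  fix v assume "v \<in> set xs"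
  then obtain s t where xs: "xs = s @ v # t" using split_list by metis
  have v: "v \<notin> set (t @ s)" "t @ s \<noteq> []" "set (t @ s) = set xs - {v}" using xs assms by auto
  have "path_edges (t @ s) \<subseteq> cycle_edges ([v] @ t @ s)"
    using path_edges_append_nonempty[of "[v]" "t @ s"] v(2) by (subst cycle_edges_conv) auto
  also have "\<dots> = cycle_edges xs"
    using cycle_edges_append_commute[of s "v # t"] xs by simp
  finally have "path_edges (t @ s) \<subseteq> {e \<in> cycle_edges xs. v \<notin> e}"
    using path_edges_subset[of _ "t @ s"] v(1) by blast
  then show "connected (set xs - {v}) {e \<in> cycle_edges xs. v \<notin> e}"
    using connected_mono[OF connected_path[OF v(2)]] v(3) by simp
qed

text \<open>Of two common vertices at least one survives the deletion of any vertex and still joins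
  the two parts.\<close>

lemma two_connected_Un:
  assumes tc: "two_connected V E" "two_connected V' E'" and sub: "\<Union> E \<subseteq> V" "\<Union> E' \<subseteq> V'"
    and fin: "finite V" "finite V'" and ab: "a \<in> V \<inter> V'" "b \<in> V \<inter> V'" "a \<noteq> b"
  shows "two_connected (V \<union> V') (E \<union> E')"
  unfolding two_connected_def
proof (intro conjI ballI)
  \<comment> \<open>Covers a deleted vertex that lies in only one of the two graphs: the other graph
    does not change.\<close>
  have del: "connected (V - {x}) {e \<in> E. x \<notin> e}" if "two_connected V E" "\<Union> E \<subseteq> V" for x and V :: "'a set" and E
  proof (cases "x \<in> V")
    case False
    then have "V - {x} = V" "{e \<in> E. x \<notin> e} = E" using that(2) by auto
    then show ?thesis using that(1) unfolding two_connected_def by simp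
  qed (use that(1) in \<open>auto simp: two_connected_def\<close>)
  have "card V \<le> card (V \<union> V')" using fin by (intro card_mono) auto
  then show "3 \<le> card (V \<union> V')" using tc(1) unfolding two_connected_def by linarith
  show "connected (V \<union> V') (E \<union> E')"
    using tc ab unfolding two_connected_def by (intro connected_Un) auto
  fix x
  have "(V - {x}) \<inter> (V' - {x}) \<noteq> {}" using ab by (cases "x = a") auto
  then have "connected ((V - {x}) \<union> (V' - {x})) ({e \<in> E. x \<notin> e} \<union> {e \<in> E'. x \<notin> e})"
    using connected_Un[OF del[OF tc(1) sub(1)] del[OF tc(2) sub(2)]] by simp
  moreover have "(V - {x}) \<union> (V' - {x}) = V \<union> V' - {x}"
    "{e \<in> E. x \<notin> e} \<union> {e \<in> E'. x \<notin> e} = {e \<in> E \<union> E'. x \<notin> e}" by auto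
  ultimately show "connected (V \<union> V' - {x}) {e \<in> E \<union> E'. x \<notin> e}" by simp
qed

text \<open>Maximizing the number of vertices plus the number of edges yields a pair that is maximal
  under inclusion in both components.\<close>

lemma block_exists:
  assumes sg: "simple_graph V E" and H: "subgraph V' E' V E" "two_connected V' E'"
  obtains VB EB where "is_block V E VB EB" "V' \<subseteq> VB" "E' \<subseteq> EB"
proof -
  have fV: "finite V" using sg unfolding simple_graph_def by blast
  have "E \<subseteq> Pow V" using simple_graph_Union[OF sg] by blast
  then have fE: "finite E" using fV finite_subset by auto
  let ?P = "\<lambda>(W, F). subgraph W F V E \<and> two_connected W F \<and> V' \<subseteq> W \<and> E' \<subseteq> F"
  let ?c = "\<lambda>(W, F). card W + card F"
  have "?c z < Suc (card V + card E)" if "?P z" for z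
    using that fV fE unfolding subgraph_def less_Suc_eq_le by (auto intro!: add_mono card_mono)
  then have "\<exists>z. ?P z \<and> (\<forall>z'. ?P z' \<longrightarrow> ?c z' \<le> ?c z)"
    using H by (intro ex_has_greatest_nat[of ?P "(V', E')" ?c "Suc (card V + card E)"]) auto
  then obtain W F where W: "?P (W, F)" and max: "\<And>W' F'. ?P (W', F') \<Longrightarrow> card W' + card F' \<le> card W + card F"
    by auto
  have "is_block V E W F"
    unfolding is_block_def
  proof (intro conjI allI impI)
    fix W' F' assume *: "subgraph W' F' V E \<and> two_connected W' F' \<and> W \<subseteq> W' \<and> F \<subseteq> F'"
    then have le: "card W' + card F' \<le> card W + card F" using max[of W' F'] W by auto
    have fin: "finite W'" "finite F'"
      using * fV fE unfolding subgraph_def by (auto intro: finite_subset)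
    then have "card W \<le> card W'" "card F \<le> card F'" using * by (auto intro: card_mono)
    then have "card W = card W'" "card F = card F'" using le by auto
    then show "W' = W" "F' = F" using * fin card_subset_eq by metis+
  qed (use W in auto)
  then show ?thesis using that W by auto
qed

lemma odd_cycles_mono:
  assumes "V \<subseteq> V'" "E \<subseteq> E'"
  shows "odd_cycles V E \<subseteq> odd_cycles V' E'"
  using assms unfolding odd_cycles_def is_cycle_def by blast

text \<open>Two cycles with a common edge share its two ends, so their union is 2-connected and lies
  in one block, where the violation would show up.\<close>

lemma G_star_if_blocks_G_star:
  assumes sg: "simple_graph V E" and blocks: "\<And>VB EB. is_block V E VB EB \<Longrightarrow> G_star VB EB"
  shows "G_star V E"
  unfolding G_star_def
proof (intro ballI impI, rule ccontr)
  fix C D assume C: "C \<in> odd_cycles V E" and D: "D \<in> odd_cycles V E" and ne: "C \<noteq> D"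
    and big: "\<not> card (C \<inter> D) \<le> 1"
  obtain xs where xs: "C = cycle_edges xs" "is_cycle V E xs" "odd (length xs)"
    using C unfolding odd_cycles_def by blast
  obtain ys where ys: "D = cycle_edges ys" "is_cycle V E ys" "odd (length ys)"
    using D unfolding odd_cycles_def by blast
  have nex: "xs \<noteq> []" "ys \<noteq> []" using xs ys unfolding is_cycle_def by auto
  have U: "\<Union> C = set xs" "\<Union> D = set ys" using xs ys nex by (auto simp: Union_cycle_edges)
  have "C \<inter> D \<noteq> {}" using big by auto
  then obtain e where e: "e \<in> C" "e \<in> D" by blast
  then have "e \<in> E" using xs unfolding is_cycle_def by blast
  then obtain a b where "a \<noteq> b" "e = {a, b}" using simple_graphE[OF sg] by metis
  then have ab: "a \<in> set xs \<inter> set ys" "b \<in> set xs \<inter> set ys" "a \<noteq> b" using e U by auto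
  have "two_connected (set xs) C" "two_connected (set ys) D"
    using xs ys two_connected_cycle unfolding is_cycle_def by auto
  then have "two_connected (set xs \<union> set ys) (C \<union> D)"
    using two_connected_Un[OF _ _ _ _ _ _ ab] U by simp
  moreover have "subgraph (set xs \<union> set ys) (C \<union> D) V E"
    using xs ys U unfolding subgraph_def is_cycle_def by blast
  ultimately obtain VB EB where B: "is_block V E VB EB" "set xs \<union> set ys \<subseteq> VB" "C \<union> D \<subseteq> EB"
    using block_exists[OF sg] by metis
  have "C \<in> odd_cycles VB EB" "D \<in> odd_cycles VB EB"
    using xs ys B(2,3) unfolding odd_cycles_def is_cycle_def by auto
  then show False using blocks[OF B(1)] ne big unfolding G_star_def by blast
qed

theorem mainTheorem1:
  fixes V :: "'a set" and E :: "'a set set"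
  assumes "simple_graph V E"
  shows "G_star V E \<longleftrightarrow>
    (\<forall>VB EB. is_block V E VB EB \<longrightarrow>
       bipartite VB EB
     \<or> graph_iso VB EB K4_verts K4_edges
     \<or> (\<exists>ps. length ps \<ge> 1 \<and> (\<forall>p \<in> set ps. even p \<and> p > 0) \<and>
            graph_iso VB EB (theta_verts (1 # ps)) (theta_edges (1 # ps))))"
    (is "_ \<longleftrightarrow> (\<forall>VB EB. _ \<longrightarrow> ?Q VB EB)")
proof -
  \<comment> \<open>The structure and transport lemmas are applied to the block as a graph in its
    own right.\<close>
  have sg: "simple_graph VB EB" if "is_block V E VB EB" for VB EB
    unfolding simple_graph_def
  proof (intro conjI ballI)
    have sub: "subgraph VB EB V E" using that unfolding is_block_def by blast
    then show "finite VB"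
      using assms unfolding subgraph_def simple_graph_def by (auto intro: finite_subset)
    fix e assume e: "e \<in> EB"
    then have "e \<in> E" "e \<subseteq> VB" using sub unfolding subgraph_def by auto
    moreover from this obtain u v where "u \<noteq> v" "e = {u, v}" using simple_graphE[OF assms] by metis
    ultimately show "\<exists>u v. u \<noteq> v \<and> u \<in> VB \<and> v \<in> VB \<and> e = {u, v}" by auto
  qed
  show ?thesis
  proof (intro iffI allI impI)
    fix VB EB assume gs: "G_star V E" and B: "is_block V E VB EB"
    then have "odd_cycles VB EB \<subseteq> odd_cycles V E"
      using odd_cycles_mono unfolding is_block_def subgraph_def by metis
    then have "G_star VB EB" using gs unfolding G_star_def by blast
    moreover have "two_connected VB EB" using B unfolding is_block_def by blast
    ultimately show "?Q VB EB"
      using G_star_two_connected_structure[OF sg[OF B]] by blast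
  next
    assume Q: "\<forall>VB EB. is_block V E VB EB \<longrightarrow> ?Q VB EB"
    show "G_star V E"
    proof (rule G_star_if_blocks_G_star[OF assms])
      fix VB EB assume B: "is_block V E VB EB"
      then have "?Q VB EB" using Q by blast
      then show "G_star VB EB"
        using bipartite_G_star G_star_graph_iso[OF _ K4_G_star sg[OF B]]
          G_star_graph_iso[OF _ even_theta_G_star sg[OF B]] by blast
    qed
  qed
qed

end
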